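(* Let $G$ be a finite group of order $n$, and let $d_1,\dots,d_s$ be the dimensions of the irreducible complex representations of $G$ (one for each isomorphism class). Then the tensor $$T_G=\sum_{\substack{g,h,k\in G\\ ghk=1}} g\otimes h\otimes k\in\mathbb{C}G\otimes\mathbb{C}G\otimes\mathbb{C}G$$ has a diagonal singular value decomposition, and its singular values are (up to ordering) $$\underbrace{\sqrt{\tfrac{n}{d_1}},\dots,\sqrt{\tfrac{n}{d_1}}}_{d_1^3},\ \underbrace{\sqrt{\tfrac{n}{d_2}},\dots,\sqrt{\tfrac{n}{d_2}}}_{d_2^3},\ \dots,\ \underbrace{\sqrt{\tfrac{n}{d_s}},\dots,\sqrt{\tfrac{n}{d_s}}}_{d_s^3}.$$
   Context: The group algebra $\mathbb{C}G$ is the Hilbert space with orthonormal basis the elements $g\in G$. For a tensor product $V=V^{(1)}\otimes\cdots\otimes V^{(d)}$ of finite dimensional Hilbert spaces (with the induced Hermitian form), a pure tensor is an element of the form $v^{(1)}\otimes\cdots\otimes v^{(d)}$ with $v^{(e)}\in V^{(e)}$. For a tuple $\mathbf{S}=(S_1,\dots,S_m)$ of tensors in $V$ and $\alpha>0$, $[\mathbf{S}]_\alpha$ is the maximum of $\big(\sum_{i=1}^m|\langle S_i,u\rangle|^\alpha\big)^{1/\alpha}$ over all pure tensors $u\in V$ of unit length. For real $t\geq 1$, a tuple $\mathbf{S}$ of tensors of unit length is called $t$-orthogonal if $[\mathbf{S}]_{2/t}=1$. A diagonal singular value decomposition of $T\in V$ is a decomposition $T=\sum_{i=1}^m\sigma_iv_i$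 where $\sigma_1\geq\cdots\geq\sigma_m>0$ are real and $(v_1,\dots,v_m)$ is a $2$-orthogonal tuple of pure tensors of unit length; $\sigma_1,\dots,\sigma_m$ are called the singular values (they are uniquely determined by $T$). *)

theory Defs
  imports
    "HOL-Analysis.Analysis"
    "Jordan_Normal_Form.VS_Connect"
begin

section \<open>Tensors\<close>

text \<open>
  A finite dimensional Hilbert space with a chosen orthonormal basis indexed by a finite set \<open>B\<close>
  is represented by the complex functions on \<open>B\<close>, extended by \<open>0\<close>.  For \<open>d\<close> such spaces with bases
  \<open>I 0, \<dots>, I (d - 1)\<close>, the products of basis vectors form an orthonormal basis of the tensor
  product for the induced Hermitian form.  This basis is indexed by the families
  \<open>x \<in> PiE {..<d} I\<close>, so a tensor is a complex function on \<open>PiE {..<d} I\<close>, extended by \<open>0\<close>.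
\<close>

definition hilbert_space :: "'a set \<Rightarrow> ('a \<Rightarrow> complex) set" where
  "hilbert_space B = {v. \<forall>x. x \<notin> B \<longrightarrow> v x = 0}"

definition basis_vec :: "'a \<Rightarrow> 'a \<Rightarrow> complex" where
  "basis_vec b = (\<lambda>x. if x = b then 1 else 0)"

type_synonym 'a tensor = "(nat \<Rightarrow> 'a) \<Rightarrow> complex"

definition tensor_space :: "nat \<Rightarrow> (nat \<Rightarrow> 'a set) \<Rightarrow> 'a tensor set" where
  "tensor_space d I = hilbert_space (PiE {..<d} I)"

definition tensor_prod :: "nat \<Rightarrow> (nat \<Rightarrow> 'a set) \<Rightarrow> (nat \<Rightarrow> 'a \<Rightarrow> complex) \<Rightarrow> 'a tensor" where
  "tensor_prod d I v = (\<lambda>x. if x \<in> PiE {..<d} I then \<Prod>e<d. v e (x e) else 0)"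

definition pure_tensor :: "nat \<Rightarrow> (nat \<Rightarrow> 'a set) \<Rightarrow> 'a tensor \<Rightarrow> bool" where
  "pure_tensor d I u \<longleftrightarrow>
    (\<exists>v. (\<forall>e<d. v e \<in> hilbert_space (I e)) \<and> u = tensor_prod d I v)"

definition hermitian_form :: "'a set \<Rightarrow> ('a \<Rightarrow> complex) \<Rightarrow> ('a \<Rightarrow> complex) \<Rightarrow> complex" where
  "hermitian_form B v w = (\<Sum>x\<in>B. v x * cnj (w x))"

definition tensor_inner :: "nat \<Rightarrow> (nat \<Rightarrow> 'a set) \<Rightarrow> 'a tensor \<Rightarrow> 'a tensor \<Rightarrow> complex" where
  "tensor_inner d I = hermitian_form (PiE {..<d} I)"

lemma tensor_inner_tensor_prod:
  assumes "\<And>e. e < d \<Longrightarrow> finite (I e)"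
  shows "tensor_inner d I (tensor_prod d I v) (tensor_prod d I w)
    = (\<Prod>e<d. hermitian_form (I e) (v e) (w e))"
proof -
  have "(\<Prod>e<d. \<Sum>x\<in>I e. v e x * cnj (w e x))
      = (\<Sum>x\<in>PiE {..<d} I. \<Prod>e<d. v e (x e) * cnj (w e (x e)))"
    using assms by (intro prod_sum_PiE) auto
  also have "\<dots> = tensor_inner d I (tensor_prod d I v) (tensor_prod d I w)"
    unfolding tensor_inner_def hermitian_form_def tensor_prod_def
    by (intro sum.cong refl) (simp add: prod.distrib)
  finally show ?thesis by (simp add: hermitian_form_def)
qed

definition tensor_norm :: "nat \<Rightarrow> (nat \<Rightarrow> 'a set) \<Rightarrow> 'a tensor \<Rightarrow> real" where
  "tensor_norm d I T = sqrt (Re (tensor_inner d I T T))"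

text \<open>
  The quantity \<open>[S]\<^sub>\<alpha>\<close> of a tuple \<open>S\<close>, given as a list.  The supremum is a maximum, because the pure
  tensors of unit length form a compact set.
\<close>

definition bracket :: "nat \<Rightarrow> (nat \<Rightarrow> 'a set) \<Rightarrow> real \<Rightarrow> 'a tensor list \<Rightarrow> real" where
  "bracket d I \<alpha> S = (SUP u \<in> {u. pure_tensor d I u \<and> tensor_norm d I u = 1}.
     (\<Sum>i<length S. cmod (tensor_inner d I (S ! i) u) powr \<alpha>) powr (1 / \<alpha>))"

definition t_orthogonal :: "nat \<Rightarrow> (nat \<Rightarrow> 'a set) \<Rightarrow> real \<Rightarrow> 'a tensor list \<Rightarrow> bool" where
  "t_orthogonal d I t S \<longleftrightarrow>
    (\<forall>T\<in>set S. T \<in> tensor_space d I \<and> tensor_norm d I T = 1) \<and> bracket d I (2 / t) S = 1"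

definition diagonal_svd ::
  "nat \<Rightarrow> (nat \<Rightarrow> 'a set) \<Rightarrow> 'a tensor \<Rightarrow> real list \<Rightarrow> 'a tensor list \<Rightarrow> bool" where
  "diagonal_svd d I T \<sigma> v \<longleftrightarrow>
    length \<sigma> = length v \<and>
    sorted_wrt (\<ge>) \<sigma> \<and> (\<forall>s\<in>set \<sigma>. s > 0) \<and>
    (\<forall>u\<in>set v. pure_tensor d I u) \<and> t_orthogonal d I 2 v \<and>
    T = (\<lambda>x. \<Sum>i<length v. complex_of_real (\<sigma> ! i) * (v ! i) x)"


section \<open>The group algebra tensor\<close>

text \<open>All three factors are the group algebra, with the elements of \<open>G\<close> as orthonormal basis.\<close>

definition group_tensor :: "('a, 'b) monoid_scheme \<Rightarrow> 'a tensor" where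
  "group_tensor G = (\<lambda>x.
    \<Sum>(g, h, k) \<in> {(g, h, k). g \<in> carrier G \<and> h \<in> carrier G \<and> k \<in> carrier G \<and>
                              g \<otimes>\<^bsub>G\<^esub> h \<otimes>\<^bsub>G\<^esub> k = \<one>\<^bsub>G\<^esub>}.
      tensor_prod 3 (\<lambda>_. carrier G) (\<lambda>e. basis_vec ([g, h, k] ! e)) x)"


section \<open>Complex representations of finite groups\<close>

text \<open>
  A representation of dimension \<open>n\<close> is a homomorphism to \<open>GL\<^sub>n\<close>, the unit group of the matrix ring.
  Its values outside the carrier of \<open>G\<close> are irrelevant.
\<close>

definition representation ::
  "('a, 'b) monoid_scheme \<Rightarrow> nat \<Rightarrow> ('a \<Rightarrow> complex mat) \<Rightarrow> bool" where
  "representation G n \<rho> \<longleftrightarrow> \<rho> \<in> hom G (units_of (ring_mat TYPE(complex) n ()))"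

definition irreducible_rep ::
  "('a, 'b) monoid_scheme \<Rightarrow> nat \<Rightarrow> ('a \<Rightarrow> complex mat) \<Rightarrow> bool" where
  "irreducible_rep G n \<rho> \<longleftrightarrow>
    representation G n \<rho> \<and> n > 0 \<and>
    (\<forall>W. subspace class_ring W (module_vec TYPE(complex) n) \<and>
         (\<forall>g\<in>carrier G. \<forall>w\<in>W. \<rho> g *\<^sub>v w \<in> W) \<longrightarrow>
         W = {0\<^sub>v n} \<or> W = carrier_vec n)"

definition isomorphic_rep ::
  "('a, 'b) monoid_scheme \<Rightarrow> nat \<Rightarrow> ('a \<Rightarrow> complex mat) \<Rightarrow> nat \<Rightarrow> ('a \<Rightarrow> complex mat) \<Rightarrow> bool" where
  "isomorphic_rep G m \<rho> n \<tau> \<longleftrightarrow>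
    m = n \<and> (\<exists>P\<in>Units (ring_mat TYPE(complex) n ()).
               \<forall>g\<in>carrier G. P * \<rho> g = \<tau> g * P)"

text \<open>
  The representations \<open>\<rho> 0, \<dots>, \<rho> (s - 1)\<close>, of dimensions \<open>d 0, \<dots>, d (s - 1)\<close>, are irreducible and
  form a system of representatives for the isomorphism classes of irreducible representations.
\<close>

definition irreducible_reps_system ::
  "('a, 'b) monoid_scheme \<Rightarrow> nat \<Rightarrow> (nat \<Rightarrow> nat) \<Rightarrow> (nat \<Rightarrow> 'a \<Rightarrow> complex mat) \<Rightarrow> bool" where
  "irreducible_reps_system G s d \<rho> \<longleftrightarrow>
    (\<forall>i<s. irreducible_rep G (d i) (\<rho> i)) \<and>
    (\<forall>i<s. \<forall>j<s. isomorphic_rep G (d i) (\<rho> i) (d j) (\<rho> j) \<longrightarrow> i = j) \<and>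
    (\<forall>n \<tau>. irreducible_rep G n \<tau> \<longrightarrow> (\<exists>i<s. isomorphic_rep G n \<tau> (d i) (\<rho> i)))"

end

theory Submission
  imports Defs "Jordan_Normal_Form.Spectral_Radius"
begin

unbundle no vec_syntax and no inner_syntax

text \<open>
  Let \<open>U\<close> run through unitary representatives of the irreducible representations. By Schur
  orthogonality the functions \<open>e\<^sub>a\<^sub>b = sqrt (d/n) U\<^sub>a\<^sub>b\<close> are orthonormal in the group algebra, and they
  form a basis: a minimal translation-invariant subspace of the orthogonal complement would consist
  of matrix coefficients. Expanding the basis vector of the neutral element gives
  \<open>(\<Sum>U. (d/n) tr (U g)) = (if g = \<one> then 1 else 0)\<close>, and with \<open>tr (U g U h U k)\<close> written out this says
  that the tensor is the sum of the terms \<open>sqrt (n/d) e\<^sub>a\<^sub>b \<otimes> e\<^sub>b\<^sub>c \<otimes> e\<^sub>c\<^sub>a\<close>. These pure tensors are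
  \<open>2\<close>-orthogonal by Bessel's inequality and two applications of Cauchy-Schwarz.

  The singular values are unique because a diagonal singular value decomposition determines
  \<open>\<Sum>i. max 0 (\<sigma>\<^sub>i - y)\<close> for each \<open>y \<ge> 0\<close>.
\<close>

section \<open>Orthonormal families of functions on a finite set\<close>

text \<open>The given representations need not be unitary, while Schur orthogonality for the
  Hermitian form is a statement about unitary matrices. Unitarity is taken from the functions on the
  group: right translation preserves the form, so its matrix in an orthonormal basis of an invariant
  space is unitary. The lemma \<open>irreducible_rep_in_invariant_subspace\<close> exploits this and
  serves both to replace each representation by a unitary one and to prove completeness. The value
  \<open>sqrt (n/d)\<close> is a matter of normalization: a term carries the weight
  \<open>d/n\<close>, and writing it with three unit vectors extracts the factor
  \<open>(n/d) powr (3/2)\<close>. The multiplicity \<open>d^3\<close> counts the index triples of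
  \<open>tr (U g U h U k)\<close>. For \<open>t = 2\<close> the exponent \<open>2 / t\<close> is 1,
  so the sums of the absolute values themselves are bounded by 1. Between two decompositions of the
  same tensor, the matrix of absolute inner products therefore has all row and column sums at most
  1; such a substochastic matrix is what makes the excess sums comparable.\<close>

lemma hermitian_form_scale_left:
  "hermitian_form B (\<lambda>x. c * v x) w = c * hermitian_form B v w"
  by (simp add: hermitian_form_def sum_distrib_left mult.assoc)

lemma hermitian_form_scale_right:
  "hermitian_form B v (\<lambda>x. c * w x) = cnj c * hermitian_form B v w"
  by (simp add: hermitian_form_def sum_distrib_left mult_ac)

lemma hermitian_form_sum_left:
  "hermitian_form B (\<lambda>x. \<Sum>j\<in>J. v j x) w = (\<Sum>j\<in>J. hermitian_form B (v j) w)"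
  unfolding hermitian_form_def sum_distrib_right by (rule sum.swap)

lemma hermitian_form_sum_right:
  "hermitian_form B v (\<lambda>x. \<Sum>j\<in>J. w j x) = (\<Sum>j\<in>J. hermitian_form B v (w j))"
  unfolding hermitian_form_def cnj_sum sum_distrib_left by (rule sum.swap)

lemma hermitian_form_diff_left:
  "hermitian_form B (\<lambda>x. v x - u x) w = hermitian_form B v w - hermitian_form B u w"
  by (simp add: hermitian_form_def left_diff_distrib sum_subtractf)

lemma hermitian_form_diff_right:
  "hermitian_form B w (\<lambda>x. v x - u x) = hermitian_form B w v - hermitian_form B w u"
  by (simp add: hermitian_form_def right_diff_distrib sum_subtractf)

lemma hermitian_form_commute: "hermitian_form B w v = cnj (hermitian_form B v w)"
  by (simp add: hermitian_form_def mult.commute)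

lemma hermitian_form_self: "hermitian_form B v v = of_real (\<Sum>x\<in>B. (cmod (v x))\<^sup>2)"
  by (simp add: hermitian_form_def complex_norm_square[symmetric])

lemma hermitian_form_self_ge_0: "Re (hermitian_form B v v) \<ge> 0"
  unfolding hermitian_form_self by (simp add: sum_nonneg)

lemma hermitian_form_self_eq_0:
  assumes "finite B" "v \<in> hilbert_space B" "hermitian_form B v v = 0"
  shows "v = (\<lambda>_. 0)"
proof
  fix x
  have "(\<Sum>x\<in>B. (cmod (v x))\<^sup>2) = 0"
    using assms(3) unfolding hermitian_form_self by (simp only: of_real_eq_0_iff)
  then have "\<forall>x\<in>B. v x = 0"
    using assms(1) by (subst (asm) sum_nonneg_eq_0_iff) auto
  then show "v x = 0" using assms(2) by (auto simp: hilbert_space_def)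
qed

lemma hermitian_form_basis_vec:
  assumes "finite B" "b \<in> B"
  shows "hermitian_form B (basis_vec b) w = cnj (w b)"
proof -
  have "hermitian_form B (basis_vec b) w = (\<Sum>x\<in>B. if x = b then cnj (w b) else 0)"
    unfolding hermitian_form_def basis_vec_def by (intro sum.cong) auto
  then show ?thesis using assms by simp
qed

section \<open>Bessel's inequality and the sizes of orthonormal families\<close>

definition orthonormal :: "'a set \<Rightarrow> 'j set \<Rightarrow> ('j \<Rightarrow> 'a \<Rightarrow> complex) \<Rightarrow> bool" where
  "orthonormal B J f \<longleftrightarrow> finite J \<and> (\<forall>j\<in>J. f j \<in> hilbert_space B) \<and>
     (\<forall>i\<in>J. \<forall>j\<in>J. hermitian_form B (f i) (f j) = (if i = j then 1 else 0))"

text \<open>For orthonormal \<open>f\<close> this is the orthogonal projection of \<open>v\<close>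
  onto the span of the family; the equation \<open>expansion B J f v = v\<close> is the form in
  which membership in the span is stated.\<close>

definition expansion :: "'a set \<Rightarrow> 'j set \<Rightarrow> ('j \<Rightarrow> 'a \<Rightarrow> complex) \<Rightarrow> ('a \<Rightarrow> complex) \<Rightarrow> 'a \<Rightarrow> complex" where
  "expansion B J f v = (\<lambda>x. \<Sum>j\<in>J. hermitian_form B v (f j) * f j x)"

lemma orthonormal_coefficient:
  assumes "orthonormal B J f" "j \<in> J"
  shows "hermitian_form B (\<lambda>x. \<Sum>i\<in>J. c i * f i x) (f j) = c j"
proof -
  have "hermitian_form B (\<lambda>x. \<Sum>i\<in>J. c i * f i x) (f j)
      = (\<Sum>i\<in>J. c i * (if i = j then 1 else 0))"
    using assms unfolding hermitian_form_sum_left hermitian_form_scale_left orthonormal_def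
    by (intro sum.cong) auto
  also have "\<dots> = (\<Sum>i\<in>J. if i = j then c j else 0)" by (intro sum.cong) auto
  also have "\<dots> = c j" using assms by (simp add: orthonormal_def)
  finally show ?thesis .
qed

lemma hermitian_form_residual:
  assumes "orthonormal B J f" "j \<in> J"
  shows "hermitian_form B (\<lambda>x. v x - expansion B J f v x) (f j) = 0"
  by (simp add: hermitian_form_diff_left expansion_def orthonormal_coefficient[OF assms])

lemma hermitian_form_expansion_right:
  "hermitian_form B w (expansion B J f v)
    = (\<Sum>j\<in>J. cnj (hermitian_form B v (f j)) * hermitian_form B w (f j))"
  by (simp add: expansion_def hermitian_form_sum_right hermitian_form_scale_right)

lemma parseval:
  assumes "orthonormal B J f"
  shows "hermitian_form B (expansion B J f v) (expansion B J f v)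
    = of_real (\<Sum>j\<in>J. (cmod (hermitian_form B v (f j)))\<^sup>2)"
proof -
  have "hermitian_form B (expansion B J f v) (f j) = hermitian_form B v (f j)" if "j \<in> J" for j
    unfolding expansion_def by (rule orthonormal_coefficient[OF assms that])
  then show ?thesis
    unfolding hermitian_form_expansion_right
    by (auto intro!: sum.cong simp del: of_real_power simp: complex_norm_square mult.commute)
qed

text \<open>The residual is orthogonal to the expansion, so its squared norm, which is nonnegative,
  equals the squared norm of \<open>v\<close> minus the sum of the squared coefficients.\<close>

lemma bessel:
  assumes "orthonormal B J f"
  shows "(\<Sum>j\<in>J. (cmod (hermitian_form B v (f j)))\<^sup>2) \<le> Re (hermitian_form B v v)"
proof -
  let ?e = "expansion B J f v" and ?S = "\<Sum>j\<in>J. (cmod (hermitian_form B v (f j)))\<^sup>2"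
  let ?r = "\<lambda>x. v x - ?e x"
  have "hermitian_form B ?r ?e = 0"
    unfolding hermitian_form_expansion_right using hermitian_form_residual[OF assms] by simp
  moreover have ve: "hermitian_form B v ?e = of_real ?S"
    unfolding hermitian_form_expansion_right
    by (auto intro!: sum.cong simp del: of_real_power simp: complex_norm_square mult.commute)
  moreover have "hermitian_form B ?e v = of_real ?S"
    by (subst hermitian_form_commute) (simp only: ve complex_cnj_complex_of_real)
  ultimately have "hermitian_form B ?r ?r = hermitian_form B v v - of_real ?S"
    by (simp add: hermitian_form_diff_right hermitian_form_diff_left del: of_real_sum)
  then show ?thesis using hermitian_form_self_ge_0[of B ?r] by simp
qed

text \<open>Double counting of the squared inner products: summed over \<open>J\<close> they give
  exactly 1 for each \<open>g k\<close>, because \<open>g k\<close> lies in the span of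
  \<open>f\<close>, and summed over \<open>K\<close> they give at most 1 for each \<open>f j\<close>
  by Bessel's inequality. This comparison takes the place of a notion of dimension.\<close>

lemma orthonormal_card_le:
  assumes f: "orthonormal B J f" and g: "orthonormal B K g"
    and g_f: "\<And>k. k \<in> K \<Longrightarrow> expansion B J f (g k) = g k"
  shows "card K \<le> card J"
proof -
  have "real (card K) = (\<Sum>k\<in>K. \<Sum>j\<in>J. (cmod (hermitian_form B (g k) (f j)))\<^sup>2)"
  proof -
    have "(\<Sum>j\<in>J. (cmod (hermitian_form B (g k) (f j)))\<^sup>2) = 1" if "k \<in> K" for k
      using parseval[OF f, of "g k"] g_f[OF that] g that
      by (metis (no_types, lifting) Re_complex_of_real one_complex.simps(1) orthonormal_def)
    then show ?thesis by simp
  qed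
  also have "\<dots> = (\<Sum>j\<in>J. \<Sum>k\<in>K. (cmod (hermitian_form B (f j) (g k)))\<^sup>2)"
    by (subst sum.swap) (simp add: hermitian_form_commute[of B "f _" "g _"])
  also have "\<dots> \<le> (\<Sum>j\<in>J. 1)"
  proof (rule sum_mono)
    fix j assume "j \<in> J"
    then show "(\<Sum>k\<in>K. (cmod (hermitian_form B (f j) (g k)))\<^sup>2) \<le> 1"
      using bessel[OF g, of "f j"] f by (simp add: orthonormal_def)
  qed
  finally show ?thesis by simp
qed

lemma orthonormal_basis_vec:
  assumes "finite B" shows "orthonormal B B basis_vec"
  using assms by (auto simp: orthonormal_def hilbert_space_def hermitian_form_basis_vec)
    (auto simp: basis_vec_def)

lemma expansion_basis_vec:
  assumes "finite B" "v \<in> hilbert_space B"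
  shows "expansion B B basis_vec v = v"
proof
  fix x
  have "hermitian_form B v (basis_vec b) = v b" if "b \<in> B" for b
    using hermitian_form_basis_vec[OF assms(1) that, of v] hermitian_form_commute[of B v "basis_vec b"]
    by simp
  then have "expansion B B basis_vec v x = (\<Sum>b\<in>B. v b * basis_vec b x)"
    by (simp add: expansion_def)
  also have "\<dots> = (\<Sum>b\<in>B. if b = x then v x else 0)"
    by (intro sum.cong) (auto simp: basis_vec_def)
  also have "\<dots> = v x" using assms by (auto simp: hilbert_space_def)
  finally show "expansion B B basis_vec v x = v x" .
qed

section \<open>Subspaces and Gram-Schmidt orthonormalization\<close>

definition linear_subspace :: "'a set \<Rightarrow> ('a \<Rightarrow> complex) set \<Rightarrow> bool" where
  "linear_subspace B V \<longleftrightarrow> V \<subseteq> hilbert_space B \<and> (\<lambda>_. 0) \<in> V \<and>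
     (\<forall>v\<in>V. \<forall>w\<in>V. (\<lambda>x. v x + w x) \<in> V) \<and> (\<forall>c. \<forall>v\<in>V. (\<lambda>x. c * v x) \<in> V)"

lemma linear_subspace_add: "linear_subspace B V \<Longrightarrow> v \<in> V \<Longrightarrow> w \<in> V \<Longrightarrow> (\<lambda>x. v x + w x) \<in> V"
  and linear_subspace_scale: "linear_subspace B V \<Longrightarrow> v \<in> V \<Longrightarrow> (\<lambda>x. c * v x) \<in> V"
  by (simp_all add: linear_subspace_def)

lemma linear_subspace_combination:
  assumes "linear_subspace B V" "\<And>j. j \<in> J \<Longrightarrow> f j \<in> V"
  shows "(\<lambda>x. \<Sum>j\<in>J. c j * f j x) \<in> V"
proof (cases "finite J")
  case True
  then show ?thesis using assms(2)
  proof (induction J)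
    case empty
    then show ?case using assms(1) by (simp add: linear_subspace_def)
  next
    case (insert j J)
    then show ?case using assms(1) by (simp add: linear_subspace_def)
  qed
next
  case False
  then show ?thesis using assms(1) by (simp add: linear_subspace_def)
qed

lemma linear_subspace_residual:
  assumes V: "linear_subspace B V" and f: "\<And>j. j \<in> J \<Longrightarrow> f j \<in> V" and v: "v \<in> V"
  shows "(\<lambda>x. v x - expansion B J f v x) \<in> V"
proof -
  have "expansion B J f v \<in> V"
    unfolding expansion_def using V f by (rule linear_subspace_combination)
  then have "(\<lambda>x. (-1) * expansion B J f v x) \<in> V"
    by (rule linear_subspace_scale[OF V])
  then have "(\<lambda>x. v x + (-1) * expansion B J f v x) \<in> V"
    by (rule linear_subspace_add[OF V v])
  then show ?thesis by simp
qed

text \<open>One Gram-Schmidt step: \<open>r\<close> is the normalized residual of \<open>v\<close>,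
  which is nonzero because \<open>v\<close> lies outside the span of the family.\<close>

lemma orthonormal_extend:
  fixes m :: nat
  assumes "finite B" and V: "linear_subspace B V"
    and f: "orthonormal B {..<m} f" "\<And>j. j < m \<Longrightarrow> f j \<in> V"
    and v: "v \<in> V" "expansion B {..<m} f v \<noteq> v"
  obtains r where "r \<in> V" "orthonormal B {..<Suc m} (f(m := r))"
proof -
  let ?r = "\<lambda>x. v x - expansion B {..<m} f v x"
  have r: "?r \<in> V" using f v V by (intro linear_subspace_residual) auto
  then have rB: "?r \<in> hilbert_space B" using V by (auto simp: linear_subspace_def)
  let ?N = "\<Sum>x\<in>B. (cmod (?r x))\<^sup>2"
  have "?N \<noteq> 0"
  proof
    assume "?N = 0"
    then have "hermitian_form B ?r ?r = 0" by (simp only: hermitian_form_self of_real_0)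
    then have "?r = (\<lambda>_. 0)" using hermitian_form_self_eq_0[OF assms(1) rB] by simp
    then have "expansion B {..<m} f v = v"
      by (intro ext) (metis eq_iff_diff_eq_0)
    then show False using v by simp
  qed
  then have N: "?N > 0" by (simp add: order_less_le sum_nonneg)
  define c where "c = complex_of_real (1 / sqrt ?N)"
  define r where "r = (\<lambda>x. c * ?r x)"
  have "r \<in> V" unfolding r_def by (rule linear_subspace_scale[OF V r])
  have "hermitian_form B r r = c * (cnj c * of_real ?N)"
    unfolding r_def hermitian_form_scale_left hermitian_form_scale_right
    by (simp only: hermitian_form_self[of B ?r])
  also have "\<dots> = of_real (1 / sqrt ?N * (1 / sqrt ?N) * ?N)"
    unfolding c_def by (simp only: complex_cnj_complex_of_real of_real_mult mult.assoc)
  also have "1 / sqrt ?N * (1 / sqrt ?N) * ?N = 1"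
  proof -
    have "1 / sqrt N * (1 / sqrt N) * N = 1" if "N > 0" for N :: real
      using that by simp
    then show ?thesis using N .
  qed
  finally have rr: "hermitian_form B r r = 1" by (simp only: of_real_1)
  have rf: "hermitian_form B r (f j) = 0" if "j < m" for j
    unfolding r_def hermitian_form_scale_left
    using hermitian_form_residual[OF f(1), of j v] that by simp
  then have "hermitian_form B (f j) r = 0" if "j < m" for j
    using that hermitian_form_commute[of B "f j" r] by simp
  then have fr: "\<And>j. j < m \<Longrightarrow> hermitian_form B (f j) r = 0" .
  have "orthonormal B {..<Suc m} (f(m := r))"
    unfolding orthonormal_def
  proof (intro conjI ballI)
    fix i j assume "i \<in> {..<Suc m}" "j \<in> {..<Suc m}"
    then show "hermitian_form B ((f(m := r)) i) ((f(m := r)) j) = (if i = j then 1 else 0)"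
      using rr rf fr f(1) by (cases "i = m"; cases "j = m") (simp_all add: orthonormal_def)
  next
    fix j assume "j \<in> {..<Suc m}"
    then show "(f(m := r)) j \<in> hilbert_space B"
      using \<open>r \<in> V\<close> f(2) V by (cases "j = m") (auto simp: linear_subspace_def)
  qed simp
  with \<open>r \<in> V\<close> show thesis by (rule that)
qed

text \<open>An orthonormal family in \<open>V\<close> of greatest size spans \<open>V\<close>, since
  otherwise a Gram-Schmidt step would enlarge it. A greatest size exists because comparison with the
  standard basis bounds all sizes by \<open>card B\<close>.\<close>

lemma orthonormal_basis_exists:
  assumes "finite B" and V: "linear_subspace B V"
  obtains m :: nat and f where "orthonormal B {..<m} f" "\<And>j. j < m \<Longrightarrow> f j \<in> V"
    "\<And>v. v \<in> V \<Longrightarrow> expansion B {..<m} f v = v"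
proof -
  let ?P = "\<lambda>m. \<exists>f. orthonormal B {..<m::nat} f \<and> (\<forall>j<m. f j \<in> V)"
  have P0: "?P 0" by (auto simp: orthonormal_def)
  have bound: "m \<le> card B" if "?P m" for m
  proof -
    from that obtain f where f: "orthonormal B {..<m} f" by auto
    have "card {..<m} \<le> card B"
      using orthonormal_basis_vec[OF assms(1)] f
      by (rule orthonormal_card_le)
        (use f assms(1) in \<open>auto simp: orthonormal_def intro: expansion_basis_vec\<close>)
    then show ?thesis by simp
  qed
  define m where "m = Greatest ?P"
  have "?P m" unfolding m_def using P0 bound by (rule GreatestI_nat)
  then obtain f where f: "orthonormal B {..<m} f" "\<And>j. j < m \<Longrightarrow> f j \<in> V" by blast
  have "expansion B {..<m} f v = v" if v: "v \<in> V" for v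
  proof (rule ccontr)
    assume "\<not> ?thesis"
    then obtain r where "r \<in> V" "orthonormal B {..<Suc m} (f(m := r))"
      using orthonormal_extend[OF assms f v] by metis
    then have "?P (Suc m)" using f(2) by (auto simp: less_Suc_eq intro!: exI[of _ "f(m := r)"])
    then have "Suc m \<le> m" using Greatest_le_nat[of ?P "Suc m" "card B"] bound unfolding m_def by blast
    then show False by simp
  qed
  with f show thesis by (rule that)
qed

section \<open>Schur's lemma\<close>

lemma Units_ring_mat_iff:
  "P \<in> Units (ring_mat TYPE(complex) n ()) \<longleftrightarrow>
    P \<in> carrier_mat n n \<and> (\<exists>Q\<in>carrier_mat n n. P * Q = 1\<^sub>m n \<and> Q * P = 1\<^sub>m n)"
  unfolding Units_def by (auto simp: ring_mat_simps)

lemma representation_carrier: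
  "representation G n \<rho> \<Longrightarrow> g \<in> carrier G \<Longrightarrow> \<rho> g \<in> carrier_mat n n"
  unfolding representation_def hom_def units_of_def
  by (auto simp: Units_ring_mat_iff Pi_iff)

lemma representation_mult:
  "representation G n \<rho> \<Longrightarrow> g \<in> carrier G \<Longrightarrow> h \<in> carrier G \<Longrightarrow> \<rho> (g \<otimes>\<^bsub>G\<^esub> h) = \<rho> g * \<rho> h"
  unfolding representation_def hom_def units_of_def by (auto simp: ring_mat_simps)

lemma representation_one:
  assumes "group G" "representation G n \<rho>"
  shows "\<rho> \<one>\<^bsub>G\<^esub> = 1\<^sub>m n"
proof -
  interpret G: group G by fact
  interpret R: ring "ring_mat TYPE(complex) n ()" by (rule ring_mat)
  have "group_hom G (units_of (ring_mat TYPE(complex) n ())) \<rho>"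
    using assms R.units_group
    unfolding group_hom_def group_hom_axioms_def representation_def by simp
  then have "\<rho> \<one>\<^bsub>G\<^esub> = \<one>\<^bsub>units_of (ring_mat TYPE(complex) n ())\<^esub>"
    by (rule group_hom.hom_one)
  then show ?thesis by (simp add: units_of_def ring_mat_simps)
qed

text \<open>Invertibility comes with the homomorphism property: the matrix of the inverse element is
  a two-sided inverse.\<close>

lemma representationI:
  assumes "group G"
    and carr: "\<And>g. g \<in> carrier G \<Longrightarrow> \<rho> g \<in> carrier_mat n n"
    and mult: "\<And>g h. g \<in> carrier G \<Longrightarrow> h \<in> carrier G \<Longrightarrow> \<rho> (g \<otimes>\<^bsub>G\<^esub> h) = \<rho> g * \<rho> h"
    and one: "\<rho> \<one>\<^bsub>G\<^esub> = 1\<^sub>m n"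
  shows "representation G n \<rho>"
proof -
  interpret G: group G by fact
  have "\<rho> g \<in> Units (ring_mat TYPE(complex) n ())" if "g \<in> carrier G" for g
    unfolding Units_ring_mat_iff
  proof (intro conjI bexI)
    show "\<rho> g * \<rho> (inv\<^bsub>G\<^esub> g) = 1\<^sub>m n" "\<rho> (inv\<^bsub>G\<^esub> g) * \<rho> g = 1\<^sub>m n"
      using that by (simp_all add: mult[symmetric] one)
  qed (use that carr in auto)
  then show ?thesis
    using mult unfolding representation_def hom_def by (auto simp: units_of_def ring_mat_simps)
qed

lemma subspace_module_vec_iff:
  "subspace class_ring W (module_vec TYPE(complex) n) \<longleftrightarrow>
    W \<subseteq> carrier_vec n \<and> 0\<^sub>v n \<in> W \<and> (\<forall>v\<in>W. \<forall>w\<in>W. v + w \<in> W) \<and> (\<forall>c. \<forall>v\<in>W. c \<cdot>\<^sub>v v \<in> W)"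
  unfolding subspace_def submodule_def
  by (auto simp: vec_vs vec_module module_vec_simps class_ring_simps)

lemma irreducible_rep_representation: "irreducible_rep G n \<rho> \<Longrightarrow> representation G n \<rho>"
  by (simp add: irreducible_rep_def)

lemma irreducible_rep_dichotomy:
  assumes "irreducible_rep G n \<rho>" "W \<subseteq> carrier_vec n" "0\<^sub>v n \<in> W"
    and "\<And>v w. v \<in> W \<Longrightarrow> w \<in> W \<Longrightarrow> v + w \<in> W" "\<And>c v. v \<in> W \<Longrightarrow> c \<cdot>\<^sub>v v \<in> W"
    and "\<And>g w. g \<in> carrier G \<Longrightarrow> w \<in> W \<Longrightarrow> \<rho> g *\<^sub>v w \<in> W"
  shows "W = {0\<^sub>v n} \<or> W = carrier_vec n"
proof -
  have "subspace class_ring W (module_vec TYPE(complex) n)"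
    unfolding subspace_module_vec_iff using assms(2-5) by simp
  moreover have "\<forall>g\<in>carrier G. \<forall>w\<in>W. \<rho> g *\<^sub>v w \<in> W" using assms(6) by simp
  ultimately show ?thesis using assms(1) unfolding irreducible_rep_def by simp
qed

lemma mat_eq_by_mult_vec:
  assumes "A \<in> carrier_mat n m" "B \<in> carrier_mat n m"
    and "\<And>v. v \<in> carrier_vec m \<Longrightarrow> A *\<^sub>v v = B *\<^sub>v v"
  shows "(A :: complex mat) = B"
proof (rule eq_matI)
  fix i j assume ij: "i < dim_row B" "j < dim_col B"
  then have "(A *\<^sub>v unit_vec m j) $ i = (B *\<^sub>v unit_vec m j) $ i" using assms by simp
  then show "A $$ (i, j) = B $$ (i, j)" using ij assms(1,2) by (simp add: scalar_prod_right_unit)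
qed (use assms in auto)

lemma mat_eq_0_by_mult_vec:
  assumes "P \<in> carrier_mat n m" "\<And>v. v \<in> carrier_vec m \<Longrightarrow> P *\<^sub>v v = 0\<^sub>v n"
  shows "(P :: complex mat) = 0\<^sub>m n m"
proof (rule mat_eq_by_mult_vec)
  show "P *\<^sub>v v = 0\<^sub>m n m *\<^sub>v v" if "v \<in> carrier_vec m" for v
    using assms that by (auto simp: scalar_prod_def intro!: eq_vecI)
qed (use assms in auto)

text \<open>Kernel and image of an intertwiner are invariant subspaces. As \<open>P\<close> is
  nonzero, irreducibility of \<open>\<rho>\<close> makes the kernel trivial and irreducibility of
  \<open>\<tau>\<close> makes the image everything.\<close>

lemma schur_isomorphic:
  assumes \<rho>: "irreducible_rep G m \<rho>" and \<tau>: "irreducible_rep G n \<tau>"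
    and P: "P \<in> carrier_mat n m" and PG: "\<And>g. g \<in> carrier G \<Longrightarrow> P * \<rho> g = \<tau> g * P"
    and nz: "P \<noteq> 0\<^sub>m n m"
  shows "isomorphic_rep G m \<rho> n \<tau>"
proof -
  have \<rho>c: "\<rho> g \<in> carrier_mat m m" and \<tau>c: "\<tau> g \<in> carrier_mat n n" if "g \<in> carrier G" for g
    using that \<rho> \<tau> by (auto simp: irreducible_rep_def representation_carrier)
  have PGv: "P *\<^sub>v (\<rho> g *\<^sub>v v) = \<tau> g *\<^sub>v (P *\<^sub>v v)" if "g \<in> carrier G" "v \<in> carrier_vec m" for g v
    using PG[OF that(1)] that P \<rho>c[OF that(1)] \<tau>c[OF that(1)] by (metis assoc_mult_mat_vec)
  let ?K = "{v \<in> carrier_vec m. P *\<^sub>v v = 0\<^sub>v n}"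
  have "?K = {0\<^sub>v m} \<or> ?K = carrier_vec m"
  proof (rule irreducible_rep_dichotomy[OF \<rho>])
    fix g w assume "g \<in> carrier G" "w \<in> ?K"
    then show "\<rho> g *\<^sub>v w \<in> ?K" using PGv \<rho>c[of g] \<tau>c[of g] by auto
  qed (use P in \<open>auto simp: mult_add_distrib_mat_vec mult_mat_vec\<close>)
  moreover have "?K \<noteq> carrier_vec m"
  proof
    assume "?K = carrier_vec m"
    then have "P = 0\<^sub>m n m" using P by (intro mat_eq_0_by_mult_vec) auto
    then show False using nz by simp
  qed
  ultimately have inj: "v = 0\<^sub>v m" if "v \<in> carrier_vec m" "P *\<^sub>v v = 0\<^sub>v n" for v
    using that by blast
  let ?I = "(\<lambda>v. P *\<^sub>v v) ` carrier_vec m"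
  have "?I = {0\<^sub>v n} \<or> ?I = carrier_vec n"
  proof (rule irreducible_rep_dichotomy[OF \<tau>])
    show "?I \<subseteq> carrier_vec n" using P by auto
    show "0\<^sub>v n \<in> ?I" using P by (intro image_eqI[of _ _ "0\<^sub>v m"]) auto
    fix v w assume "v \<in> ?I" "w \<in> ?I"
    then show "v + w \<in> ?I" using P
      by (auto simp: mult_add_distrib_mat_vec[symmetric])
  next
    fix c v assume "v \<in> ?I"
    then show "c \<cdot>\<^sub>v v \<in> ?I" using P by (auto simp: mult_mat_vec[symmetric])
  next
    fix g w assume "g \<in> carrier G" "w \<in> ?I"
    then show "\<tau> g *\<^sub>v w \<in> ?I" using \<rho>c[of g] by (auto simp: PGv[symmetric])
  qed
  moreover have "?I \<noteq> {0\<^sub>v n}"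
  proof
    assume "?I = {0\<^sub>v n}"
    then have "P = 0\<^sub>m n m" using P by (intro mat_eq_0_by_mult_vec) auto
    then show False using nz by simp
  qed
  ultimately have "\<forall>i<n. \<exists>v\<in>carrier_vec m. P *\<^sub>v v = unit_vec n i"
    by (metis (no_types, lifting) image_iff unit_vec_carrier)
  then obtain q where q: "\<And>i. i < n \<Longrightarrow> q i \<in> carrier_vec m" "\<And>i. i < n \<Longrightarrow> P *\<^sub>v q i = unit_vec n i"
    by metis
  \<comment> \<open>The columns are preimages of the unit vectors, so \<open>P * Q\<close> is the
    identity by construction; the other product follows from injectivity of
    \<open>P\<close>.\<close>
  define Q where "Q = mat_of_cols m (map q [0..<n])"
  have Q: "Q \<in> carrier_mat m n" unfolding Q_def by (metis length_map length_upt minus_nat.diff_0 mat_of_cols_carrier(1))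
  have "col Q i = q i" if "i < n" for i
    unfolding Q_def using that q by (subst col_mat_of_cols) auto
  then have "P *\<^sub>v col Q i = unit_vec n i" if "i < n" for i using that q by simp
  then have "col (P * Q) i = col (1\<^sub>m n) i" if "i < n" for i
    using that P Q by (simp only: col_mult2[OF P Q] col_one)
  then have PQ: "P * Q = 1\<^sub>m n"
    using P Q by (intro mat_col_eqI) simp_all
  have QP: "Q * P = 1\<^sub>m m"
  proof (rule mat_eq_by_mult_vec)
    fix v :: "complex vec" assume v: "v \<in> carrier_vec m"
    have QPv: "Q * P *\<^sub>v v \<in> carrier_vec m" using P Q v by auto
    have "P *\<^sub>v (Q * P *\<^sub>v v) = P * (Q * P) *\<^sub>v v"
      using P Q v by (intro assoc_mult_mat_vec[symmetric]) auto
    also have "P * (Q * P) = P * Q * P" using P Q by (intro assoc_mult_mat[symmetric])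
    also have "P * Q * P *\<^sub>v v = P *\<^sub>v v" using PQ P by simp
    finally have "P *\<^sub>v (Q * P *\<^sub>v v - v) = 0\<^sub>v n" using P QPv v
      by (simp add: mult_minus_distrib_mat_vec)
    then have "Q * P *\<^sub>v v - v = 0\<^sub>v m" using QPv v by (intro inj) auto
    then have "(Q * P *\<^sub>v v) $ i = v $ i" if "i < m" for i
      using QPv v that by (metis carrier_vecD eq_iff_diff_eq_0 index_minus_vec(1) index_zero_vec(1))
    then have "Q * P *\<^sub>v v = v" using P Q v by (intro eq_vecI) auto
    then show "Q * P *\<^sub>v v = 1\<^sub>m m *\<^sub>v v" using v by simp
  qed (use P Q in auto)
  \<comment> \<open>comparison of the traces of \<open>P * Q\<close> and \<open>Q * P\<close>\<close>
  have "(of_nat n :: complex) = (\<Sum>i<n. (P * Q) $$ (i, i))" by (simp add: PQ)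
  also have "\<dots> = (\<Sum>i<n. \<Sum>j<m. P $$ (i, j) * Q $$ (j, i))"
    using P Q by (simp add: scalar_prod_def atLeast0LessThan)
  also have "\<dots> = (\<Sum>j<m. \<Sum>i<n. Q $$ (j, i) * P $$ (i, j))"
    by (subst sum.swap) (simp add: mult.commute)
  also have "\<dots> = (\<Sum>j<m. (Q * P) $$ (j, j))"
    using P Q by (simp add: scalar_prod_def atLeast0LessThan)
  also have "\<dots> = of_nat m" by (simp add: QP)
  finally have "m = n" by simp
  then have "P \<in> Units (ring_mat TYPE(complex) n ())"
    unfolding Units_ring_mat_iff using P Q PQ QP by auto
  with \<open>m = n\<close> PG show ?thesis unfolding isomorphic_rep_def by blast
qed

text \<open>Over the complex numbers \<open>A\<close> has an eigenvalue. Its eigenspace is nonzero,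
  and invariant because \<open>A\<close> commutes with \<open>\<rho>\<close>, so it is the whole
  space.\<close>

lemma schur_scalar:
  assumes \<rho>: "irreducible_rep G n \<rho>" and A: "A \<in> carrier_mat n n"
    and comm: "\<And>g. g \<in> carrier G \<Longrightarrow> A * \<rho> g = \<rho> g * A"
  obtains c where "A = c \<cdot>\<^sub>m 1\<^sub>m n"
proof -
  have "n > 0" using \<rho> by (simp add: irreducible_rep_def)
  then obtain c where "eigenvalue A c"
    using spectrum_non_empty[OF A] by (auto simp: spectrum_def)
  then obtain u where u: "u \<in> carrier_vec n" "u \<noteq> 0\<^sub>v n" "A *\<^sub>v u = c \<cdot>\<^sub>v u"
    using A by (auto simp: eigenvalue_def eigenvector_def)
  have \<rho>c: "\<rho> g \<in> carrier_mat n n" if "g \<in> carrier G" for g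
    using that \<rho> by (auto simp: irreducible_rep_def representation_carrier)
  let ?K = "{v \<in> carrier_vec n. A *\<^sub>v v = c \<cdot>\<^sub>v v}"
  have "?K = {0\<^sub>v n} \<or> ?K = carrier_vec n"
  proof (rule irreducible_rep_dichotomy[OF \<rho>])
    show "0\<^sub>v n \<in> ?K" using A by auto
    fix g w assume g: "g \<in> carrier G" and w: "w \<in> ?K"
    have "A *\<^sub>v (\<rho> g *\<^sub>v w) = \<rho> g *\<^sub>v (A *\<^sub>v w)"
      using comm[OF g] A \<rho>c[OF g] w by (metis (no_types, lifting) assoc_mult_mat_vec mem_Collect_eq)
    then show "\<rho> g *\<^sub>v w \<in> ?K" using \<rho>c[OF g] w by (auto simp: mult_mat_vec)
  qed (use A in \<open>auto simp: mult_add_distrib_mat_vec mult_mat_vec smult_add_distrib_vec smult_smult_assoc mult.commute\<close>)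
  then have "?K = carrier_vec n" using u by blast
  have "A = c \<cdot>\<^sub>m 1\<^sub>m n"
  proof (intro mat_eq_by_mult_vec[of _ n n])
    fix v :: "complex vec" assume v: "v \<in> carrier_vec n"
    then have "A *\<^sub>v v = c \<cdot>\<^sub>v v" using \<open>?K = carrier_vec n\<close> by blast
    also have "\<dots> = (c \<cdot>\<^sub>m 1\<^sub>m n) *\<^sub>v v" using v by auto
    finally show "A *\<^sub>v v = (c \<cdot>\<^sub>m 1\<^sub>m n) *\<^sub>v v" .
  qed (use A in auto)
  then show thesis by (rule that)
qed

lemma isomorphic_rep_sym:
  assumes iso: "isomorphic_rep G m \<rho> n \<tau>"
    and \<rho>: "representation G m \<rho>" and \<tau>: "representation G n \<tau>"
  shows "isomorphic_rep G n \<tau> m \<rho>"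
proof -
  from iso obtain P Q where mn: "m = n"
    and P: "P \<in> carrier_mat n n" and Q: "Q \<in> carrier_mat n n" "P * Q = 1\<^sub>m n" "Q * P = 1\<^sub>m n"
    and PG: "\<And>g. g \<in> carrier G \<Longrightarrow> P * \<rho> g = \<tau> g * P"
    unfolding isomorphic_rep_def Bex_def Units_ring_mat_iff by metis
  have "Q * \<tau> g = \<rho> g * Q" if "g \<in> carrier G" for g
  proof -
    have c: "\<rho> g \<in> carrier_mat n n" "\<tau> g \<in> carrier_mat n n"
      using that \<rho> \<tau> mn by (auto simp: representation_carrier)
    have "Q * \<tau> g = Q * (\<tau> g * (P * Q))" using c Q by simp
    also have "\<dots> = Q * (\<tau> g * P * Q)" using c P Q by (simp add: assoc_mult_mat[of _ n n _ n])
    also have "\<dots> = Q * (P * \<rho> g * Q)" by (simp only: PG[OF that])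
    also have "\<dots> = Q * P * (\<rho> g * Q)" using c P Q(1) by (simp add: assoc_mult_mat[of _ n n _ n _ n])
    also have "\<dots> = \<rho> g * Q" using c Q by simp
    finally show ?thesis .
  qed
  moreover have "Q \<in> Units (ring_mat TYPE(complex) m ())"
    unfolding Units_ring_mat_iff using P Q mn by auto
  ultimately show ?thesis using mn unfolding isomorphic_rep_def by blast
qed

lemma isomorphic_rep_trans:
  assumes "isomorphic_rep G m \<rho> n \<tau>" "isomorphic_rep G n \<tau> k \<kappa>"
    and \<rho>: "representation G m \<rho>" and \<tau>: "representation G n \<tau>" and \<kappa>: "representation G k \<kappa>"
  shows "isomorphic_rep G m \<rho> k \<kappa>"
proof -
  from assms(1,2) obtain P Q where mn: "m = n" "n = k"
    and P: "P \<in> Units (ring_mat TYPE(complex) k ())" "\<And>g. g \<in> carrier G \<Longrightarrow> P * \<rho> g = \<tau> g * P"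
    and Q: "Q \<in> Units (ring_mat TYPE(complex) k ())" "\<And>g. g \<in> carrier G \<Longrightarrow> Q * \<tau> g = \<kappa> g * Q"
    unfolding isomorphic_rep_def by blast
  have PQ: "P \<in> carrier_mat k k" "Q \<in> carrier_mat k k" using P Q by (auto simp: Units_ring_mat_iff)
  have "Q * P * \<rho> g = \<kappa> g * (Q * P)" if "g \<in> carrier G" for g
  proof -
    have c: "\<rho> g \<in> carrier_mat k k" "\<tau> g \<in> carrier_mat k k" "\<kappa> g \<in> carrier_mat k k"
      using that \<rho> \<tau> \<kappa> mn by (auto simp: representation_carrier)
    have "Q * P * \<rho> g = Q * (\<tau> g * P)"
      using c PQ P(2)[OF that] by (simp add: assoc_mult_mat[of _ k k _ k _ k])
    also have "\<dots> = Q * \<tau> g * P" using c PQ by (simp add: assoc_mult_mat[of _ k k _ k _ k])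
    also have "\<dots> = \<kappa> g * (Q * P)"
      using c PQ Q(2)[OF that] by (simp add: assoc_mult_mat[of _ k k _ k _ k])
    finally show ?thesis .
  qed
  moreover have "Q * P \<in> Units (ring_mat TYPE(complex) k ())"
  proof -
    interpret R: ring "ring_mat TYPE(complex) k ()" by (rule ring_mat)
    show ?thesis using R.Units_m_closed[OF Q(1) P(1)] by (simp add: ring_mat_simps)
  qed
  ultimately show ?thesis using mn unfolding isomorphic_rep_def by blast
qed

section \<open>Translation-invariant spaces of functions on a finite group\<close>

text \<open>Right translation, so that \<open>g\<close> followed by \<open>h\<close> composes in the
  order of a left action (see \<open>translate_translate\<close>). The value 0 outside the carrier
  keeps the result in \<open>hilbert_space (carrier G)\<close>.\<close>

definition translate :: "('a, 'b) monoid_scheme \<Rightarrow> 'a \<Rightarrow> ('a \<Rightarrow> complex) \<Rightarrow> 'a \<Rightarrow> complex" where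
  "translate G g f = (\<lambda>x. if x \<in> carrier G then f (x \<otimes>\<^bsub>G\<^esub> g) else 0)"

definition translation_invariant :: "('a, 'b) monoid_scheme \<Rightarrow> ('a \<Rightarrow> complex) set \<Rightarrow> bool" where
  "translation_invariant G V \<longleftrightarrow> (\<forall>g\<in>carrier G. \<forall>f\<in>V. translate G g f \<in> V)"

text \<open>Since \<open>U (inv g)\<close> is the inverse of \<open>U g\<close>, the entrywise
  condition says that the inverse is the conjugate transpose.\<close>

definition unitary_rep :: "('a, 'b) monoid_scheme \<Rightarrow> nat \<Rightarrow> ('a \<Rightarrow> complex mat) \<Rightarrow> bool" where
  "unitary_rep G n U \<longleftrightarrow> representation G n U \<and>
     (\<forall>g\<in>carrier G. \<forall>a<n. \<forall>b<n. U (inv\<^bsub>G\<^esub> g) $$ (a, b) = cnj (U g $$ (b, a)))"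

lemma translate_combination:
  "translate G g (\<lambda>x. \<Sum>j\<in>J. c j * f j x) = (\<lambda>x. \<Sum>j\<in>J. c j * translate G g (f j) x)"
  by (auto simp: translate_def)

locale finite_group = group G for G (structure) +
  assumes finite_carrier: "finite (carrier G)"
begin

lemma translate_translate:
  "g \<in> carrier G \<Longrightarrow> h \<in> carrier G \<Longrightarrow> translate G g (translate G h f) = translate G (g \<otimes> h) f"
  by (auto simp: translate_def m_assoc)

lemma translate_one: "f \<in> hilbert_space (carrier G) \<Longrightarrow> translate G \<one> f = f"
  by (auto simp: translate_def hilbert_space_def)

text \<open>Right multiplication permutes the group, hence translation is a unitary operator. All
  unitarity in the development originates here.\<close>

lemma hermitian_form_translate:
  assumes g: "g \<in> carrier G"
  shows "hermitian_form (carrier G) (translate G g v) w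
    = hermitian_form (carrier G) v (translate G (inv g) w)"
  unfolding hermitian_form_def
  by (rule sum.reindex_bij_witness[of _ "\<lambda>y. y \<otimes> inv g" "\<lambda>x. x \<otimes> g"])
    (use g in \<open>auto simp: translate_def m_assoc\<close>)

text \<open>Among the nonzero invariant subspaces of \<open>V\<close>, one of least dimension is
  chosen, and \<open>U g\<close> is the matrix of translation by \<open>g\<close> in an orthonormal
  basis \<open>f\<close> of it. An invariant subspace of the coordinate space corresponds to an
  invariant subspace of functions, so minimality gives irreducibility.\<close>

lemma irreducible_rep_in_invariant_subspace:
  assumes V: "linear_subspace (carrier G) V" "translation_invariant G V"
    and v: "v \<in> V" "v \<noteq> (\<lambda>_. 0)"
  shows "\<exists>m U f. irreducible_rep G m U \<and> unitary_rep G m U \<and>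
    orthonormal (carrier G) {..<m} f \<and> (\<forall>b<m. f b \<in> V) \<and>
    (\<forall>g\<in>carrier G. \<forall>b<m.
      translate G g (f b) = (\<lambda>x. \<Sum>a<m. U g $$ (a, b) * f a x))"
proof -
  \<comment> \<open>The number \<open>m\<close> plays the role of the dimension of \<open>W\<close>;
    requiring \<open>0 < m\<close> excludes the zero subspace from the minimization below.\<close>
  define basis where "basis = (\<lambda>W (m::nat) f. linear_subspace (carrier G) W \<and> W \<subseteq> V \<and>
    translation_invariant G W \<and> 0 < m \<and> orthonormal (carrier G) {..<m} f \<and>
    (\<forall>j<m. f j \<in> W) \<and> (\<forall>v\<in>W. expansion (carrier G) {..<m} f v = v))"
  have basis_exists: "\<exists>m f. basis W m f"
    if W: "linear_subspace (carrier G) W" "W \<subseteq> V" "translation_invariant G W"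
      and w: "w \<in> W" "w \<noteq> (\<lambda>_. 0)" for W w
  proof -
    from orthonormal_basis_exists[OF finite_carrier W(1)] obtain m :: nat and f
      where f: "orthonormal (carrier G) {..<m} f" "\<And>j. j < m \<Longrightarrow> f j \<in> W"
        "\<And>v. v \<in> W \<Longrightarrow> expansion (carrier G) {..<m} f v = v"
      by metis
    have "m > 0" using f(3)[OF w(1)] w(2) by (cases m) (auto simp: expansion_def)
    with W f have "basis W m f" unfolding basis_def by simp
    then show ?thesis by blast
  qed
  define m where "m = (LEAST m. \<exists>W f. basis W m f)"
  have "\<exists>m W f. basis W m f" using basis_exists[OF V(1) order.refl V(2) v] by blast
  then have "\<exists>W f. basis W m f" unfolding m_def by (rule LeastI_ex)
  then obtain W f where "basis W m f" by blast
  then have W: "linear_subspace (carrier G) W" "W \<subseteq> V" "translation_invariant G W"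
    and "0 < m" and f: "orthonormal (carrier G) {..<m} f" and fW: "\<And>j. j < m \<Longrightarrow> f j \<in> W"
    and expand: "\<And>v. v \<in> W \<Longrightarrow> expansion (carrier G) {..<m} f v = v"
    unfolding basis_def by auto
  have fB: "f j \<in> hilbert_space (carrier G)" if "j < m" for j
    using f that by (simp add: orthonormal_def)
  define U where "U = (\<lambda>g. Matrix.mat m m
    (\<lambda>(a, b). hermitian_form (carrier G) (translate G g (f b)) (f a)))"
  have Uc: "U g \<in> carrier_mat m m" for g by (simp add: U_def)
  have U_entry: "U g $$ (a, b) = hermitian_form (carrier G) (translate G g (f b)) (f a)"
    if "a < m" "b < m" for g a b
    using that by (simp add: U_def)
  have tr: "translate G g (f b) = (\<lambda>x. \<Sum>a<m. U g $$ (a, b) * f a x)"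
    if g: "g \<in> carrier G" and b: "b < m" for g b
  proof -
    have "translate G g (f b) \<in> W"
      using W(3) fW[OF b] g by (auto simp: translation_invariant_def)
    from expand[OF this] show ?thesis using b by (simp add: expansion_def U_entry)
  qed
  have rep: "representation G m U"
  proof (rule representationI)
    show "group G" by (rule is_group)
    show "U g \<in> carrier_mat m m" for g by (rule Uc)
    show "U (g \<otimes> h) = U g * U h" if gh: "g \<in> carrier G" "h \<in> carrier G" for g h
    proof (rule eq_matI)
      fix a b assume "a < dim_row (U g * U h)" "b < dim_col (U g * U h)"
      then have ab: "a < m" "b < m" using Uc[of g] Uc[of h] by auto
      have "translate G (g \<otimes> h) (f b) = translate G g (\<lambda>x. \<Sum>c<m. U h $$ (c, b) * f c x)"
        using tr[OF gh(2) ab(2)] translate_translate[OF gh, of "f b"] by simp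
      then have "translate G (g \<otimes> h) (f b) = (\<lambda>x. \<Sum>c<m. U h $$ (c, b) * translate G g (f c) x)"
        unfolding translate_combination .
      then have "U (g \<otimes> h) $$ (a, b)
          = (\<Sum>c<m. U h $$ (c, b) * hermitian_form (carrier G) (translate G g (f c)) (f a))"
        unfolding U_entry[OF ab] by (simp add: hermitian_form_sum_left hermitian_form_scale_left)
      also have "\<dots> = (\<Sum>c<m. U g $$ (a, c) * U h $$ (c, b))"
        using ab by (simp add: U_entry mult.commute)
      also have "\<dots> = (U g * U h) $$ (a, b)"
        using ab Uc[of g] Uc[of h] by (simp add: scalar_prod_def atLeast0LessThan)
      finally show "U (g \<otimes> h) $$ (a, b) = (U g * U h) $$ (a, b)" .
    qed (use Uc[of g] Uc[of h] Uc[of "g \<otimes> h"] in auto)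
    show "U \<one> = 1\<^sub>m m"
    proof (rule eq_matI)
      fix a b assume "a < dim_row (1\<^sub>m m :: complex mat)" "b < dim_col (1\<^sub>m m :: complex mat)"
      then show "U \<one> $$ (a, b) = 1\<^sub>m m $$ (a, b)"
        using f fB by (auto simp: U_entry translate_one orthonormal_def)
    qed (use Uc[of \<one>] in auto)
  qed
  have unitary: "unitary_rep G m U"
    unfolding unitary_rep_def
  proof (intro conjI rep ballI allI impI)
    fix g a b assume "g \<in> carrier G" and ab: "a < m" "b < m"
    then have "hermitian_form (carrier G) (translate G (inv g) (f b)) (f a)
        = hermitian_form (carrier G) (f b) (translate G g (f a))"
      using hermitian_form_translate[of "inv g" "f b" "f a"] by simp
    then show "U (inv g) $$ (a, b) = cnj (U g $$ (b, a))"
      using ab by (simp add: U_entry hermitian_form_commute[of _ "f b"])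
  qed
  have "irreducible_rep G m U"
    unfolding irreducible_rep_def
  proof (intro conjI rep \<open>0 < m\<close> allI impI)
    fix W' :: "complex Matrix.vec set"
    assume "subspace class_ring W' (module_vec TYPE(complex) m) \<and>
      (\<forall>g\<in>carrier G. \<forall>w\<in>W'. U g *\<^sub>v w \<in> W')"
    note this[unfolded subspace_module_vec_iff]
    then have W'c: "W' \<subseteq> carrier_vec m" and W'0: "0\<^sub>v m \<in> W'"
      and W'add: "\<And>v w. v \<in> W' \<Longrightarrow> w \<in> W' \<Longrightarrow> v + w \<in> W'"
      and W'scale: "\<And>c v. v \<in> W' \<Longrightarrow> c \<cdot>\<^sub>v v \<in> W'"
      and W'inv: "\<And>g w. g \<in> carrier G \<Longrightarrow> w \<in> W' \<Longrightarrow> U g *\<^sub>v w \<in> W'"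
      by simp_all
    \<comment> \<open>\<open>L\<close> identifies coordinate vectors with functions in
      \<open>W\<close>; under it, multiplication by \<open>U g\<close> becomes translation by
      \<open>g\<close>.\<close>
    define L where "L = (\<lambda>w x. \<Sum>a<m. w $ a * f a x)"
    have L_coeff: "hermitian_form (carrier G) (L w) (f a) = w $ a" if "a < m" for w a
      unfolding L_def using orthonormal_coefficient[OF f, of a] that by simp
    have LW: "L w \<in> W" for w
      unfolding L_def using W(1) fW by (intro linear_subspace_combination) auto
    have lin: "linear_subspace (carrier G) (L ` W')"
      unfolding linear_subspace_def
    proof (intro conjI ballI allI)
      show "L ` W' \<subseteq> hilbert_space (carrier G)" using LW W(1) by (auto simp: linear_subspace_def)
      show "(\<lambda>_. 0) \<in> L ` W'" using W'0 by (intro image_eqI[of _ _ "0\<^sub>v m"]) (auto simp: L_def)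
      fix v assume "v \<in> L ` W'"
      then obtain p where p: "p \<in> W'" "v = L p" by blast
      have pc: "p \<in> carrier_vec m" using p W'c by blast
      have "(\<lambda>x. c * v x) = L (c \<cdot>\<^sub>v p)" for c
        using pc by (simp add: L_def p(2) sum_distrib_left mult.assoc)
      then show "(\<lambda>x. c * v x) \<in> L ` W'" for c
        using W'scale[OF p(1)] by blast
      fix w assume "w \<in> L ` W'"
      then obtain q where q: "q \<in> W'" "w = L q" by blast
      have qc: "q \<in> carrier_vec m" using q W'c by blast
      have "(\<lambda>x. v x + w x) = L (p + q)"
        using pc qc by (simp add: L_def p(2) q(2) sum.distrib distrib_right)
      then show "(\<lambda>x. v x + w x) \<in> L ` W'"
        using W'add[OF p(1) q(1)] by blast
    qed
    have sub: "L ` W' \<subseteq> V" using LW W(2) by auto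
    have inv: "translation_invariant G (L ` W')"
      unfolding translation_invariant_def
    proof (intro ballI)
      fix g v assume g: "g \<in> carrier G" and "v \<in> L ` W'"
      then obtain p where p: "p \<in> W'" "v = L p" by blast
      have pc: "p \<in> carrier_vec m" using p W'c by blast
      have "translate G g v = (\<lambda>x. \<Sum>b<m. p $ b * (\<Sum>a<m. U g $$ (a, b) * f a x))"
        unfolding p(2) L_def translate_combination using tr[OF g] by simp
      also have "\<dots> = (\<lambda>x. \<Sum>a<m. (\<Sum>b<m. U g $$ (a, b) * p $ b) * f a x)"
        unfolding sum_distrib_left sum_distrib_right
        by (subst sum.swap) (simp add: mult_ac)
      also have "\<dots> = L (U g *\<^sub>v p)"
        unfolding L_def using Uc[of g] pc by (simp add: scalar_prod_def atLeast0LessThan)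
      finally show "translate G g v \<in> L ` W'" using W'inv[OF g p(1)] by simp
    qed
    show "W' = {0\<^sub>v m} \<or> W' = carrier_vec m"
    proof (rule ccontr)
      assume contra: "\<not> ?thesis"
      then obtain w where w: "w \<in> W'" "w \<noteq> 0\<^sub>v m" using W'0 by blast
      then obtain a where "a < m" "w $ a \<noteq> 0" using W'c by (metis carrier_vecD eq_vecI index_zero_vec subsetD)
      then have "L w \<noteq> (\<lambda>_. 0)" using L_coeff[of a w] by (auto simp: hermitian_form_def)
      then obtain m' e where "basis (L ` W') m' e"
        using basis_exists[OF lin sub inv] w(1) by blast
      then have "m \<le> m'" unfolding m_def by (intro Least_le) blast
      from \<open>basis (L ` W') m' e\<close> have e: "orthonormal (carrier G) {..<m'} e" "\<And>j. j < m' \<Longrightarrow> e j \<in> L ` W'"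
        by (auto simp: basis_def)
      from contra obtain u where u: "u \<in> carrier_vec m" "u \<notin> W'" using W'c by blast
      have "L u \<notin> L ` W'"
      proof
        assume "L u \<in> L ` W'"
        then obtain q where q: "q \<in> W'" "L u = L q" by blast
        then have "u $ a = q $ a" if "a < m" for a using L_coeff[OF that] by metis
        then have "u = q" using u q W'c by (intro eq_vecI) auto
        then show False using u q by simp
      qed
      moreover have "expansion (carrier G) {..<m'} e (L u) \<in> L ` W'"
        unfolding expansion_def using lin e(2) by (intro linear_subspace_combination) auto
      ultimately have ne: "expansion (carrier G) {..<m'} e (L u) \<noteq> L u" by metis
      have eW: "e j \<in> W" if "j < m'" for j using e(2)[OF that] LW by auto
      \<comment> \<open>Since \<open>L u\<close> lies in \<open>W\<close> but outside the span of
        \<open>e\<close>, the family \<open>e\<close> grows to \<open>Suc m'\<close> orthonormal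
        functions in \<open>W\<close>. A space spanned by \<open>m\<close> functions then forces
        \<open>Suc m' \<le> m\<close>, against \<open>m \<le> m'\<close>.\<close>
      obtain r where r: "r \<in> W" "orthonormal (carrier G) {..<Suc m'} (e(m' := r))"
        using orthonormal_extend[OF finite_carrier W(1) e(1) eW LW ne] by metis
      have "card {..<Suc m'} \<le> card {..<m}"
      proof (rule orthonormal_card_le[OF f r(2)])
        fix k assume "k \<in> {..<Suc m'}"
        then have "(e(m' := r)) k \<in> W" using eW r(1) by (auto simp: less_Suc_eq)
        then show "expansion (carrier G) {..<m} f ((e(m' := r)) k) = (e(m' := r)) k" by (rule expand)
      qed
      then show False using \<open>m \<le> m'\<close> by simp
    qed
  qed
  then show ?thesis using unitary f tr fW W(2)
    by (intro exI[of _ m] exI[of _ U] exI[of _ f]) auto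
qed

text \<open>The row functions span an invariant space \<open>V\<close>, nonzero because
  \<open>F 0\<close> takes the value 1 at the neutral element. An irreducible piece of
  \<open>V\<close> carries a unitary representation \<open>U\<close>, and Schur's lemma identifies
  it with \<open>\<rho>\<close> as soon as a nonzero intertwiner is found.\<close>

lemma irreducible_rep_unitarizable:
  assumes \<rho>: "irreducible_rep G n \<rho>"
  obtains U where "irreducible_rep G n U" "unitary_rep G n U" "isomorphic_rep G n \<rho> n U"
proof -
  have rep: "representation G n \<rho>" and n: "n > 0" using \<rho> by (auto simp: irreducible_rep_def)
  have \<rho>c: "\<rho> g \<in> carrier_mat n n" if "g \<in> carrier G" for g
    using rep that by (rule representation_carrier)
  \<comment> \<open>the first row of \<open>\<rho>\<close> spans a copy of \<open>\<rho>\<close> inside the functions on \<open>G\<close>\<close>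
  define F where "F = (\<lambda>j x. if x \<in> carrier G then \<rho> x $$ (0, j) else 0)"
  define V where "V = range (\<lambda>c x. \<Sum>j<n. c j * F j x)"
  have trF: "translate G g (F j) = (\<lambda>x. \<Sum>k<n. \<rho> g $$ (k, j) * F k x)"
    if g: "g \<in> carrier G" and j: "j < n" for g j
  proof
    fix x
    show "translate G g (F j) x = (\<Sum>k<n. \<rho> g $$ (k, j) * F k x)"
    proof (cases "x \<in> carrier G")
      case True
      then have "translate G g (F j) x = (\<rho> x * \<rho> g) $$ (0, j)"
        using g representation_mult[OF rep True g] by (simp add: translate_def F_def)
      also have "\<dots> = (\<Sum>k<n. \<rho> x $$ (0, k) * \<rho> g $$ (k, j))"
        using \<rho>c[OF True] \<rho>c[OF g] j n by (simp add: scalar_prod_def atLeast0LessThan)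
      finally show ?thesis using True by (simp add: F_def mult.commute)
    qed (simp add: translate_def F_def)
  qed
  have lin: "linear_subspace (carrier G) V"
    unfolding linear_subspace_def
  proof (intro conjI ballI allI)
    show "V \<subseteq> hilbert_space (carrier G)" by (auto simp: V_def hilbert_space_def F_def)
    show "(\<lambda>_. 0) \<in> V" unfolding V_def by (rule range_eqI[of _ _ "\<lambda>_. 0"]) simp
    fix v assume "v \<in> V"
    then obtain p where p: "v = (\<lambda>x. \<Sum>j<n. p j * F j x)" by (auto simp: V_def)
    show "(\<lambda>x. c * v x) \<in> V" for c
      unfolding V_def p
      by (rule range_eqI[of _ _ "\<lambda>j. c * p j"]) (simp add: sum_distrib_left mult.assoc)
    fix w assume "w \<in> V"
    then obtain q where q: "w = (\<lambda>x. \<Sum>j<n. q j * F j x)" by (auto simp: V_def)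
    show "(\<lambda>x. v x + w x) \<in> V"
      unfolding V_def p q
      by (rule range_eqI[of _ _ "\<lambda>j. p j + q j"]) (simp add: sum.distrib distrib_right)
  qed
  have FV: "F j \<in> V" if "j < n" for j
    unfolding V_def using that
    by (intro range_eqI[of _ _ "\<lambda>i. if i = j then 1 else 0"] ext)
      (simp add: if_distrib[of "\<lambda>c. c * _"] cong: if_cong)
  have inv: "translation_invariant G V"
    unfolding translation_invariant_def
  proof (intro ballI)
    fix g v assume g: "g \<in> carrier G" and "v \<in> V"
    then obtain p where p: "v = (\<lambda>x. \<Sum>j<n. p j * F j x)" by (auto simp: V_def)
    have "translate G g (F j) \<in> V" if "j < n" for j
      unfolding trF[OF g that] using lin FV by (intro linear_subspace_combination) auto
    then show "translate G g v \<in> V"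
      unfolding p translate_combination using lin by (intro linear_subspace_combination) auto
  qed
  have "F 0 \<one> = 1" using n by (simp add: F_def representation_one[OF is_group rep])
  then have "F 0 \<noteq> (\<lambda>_. 0)" by auto
  from irreducible_rep_in_invariant_subspace[OF lin inv FV[OF n] this]
  obtain m U f where U: "irreducible_rep G m U" "unitary_rep G m U"
    and f: "orthonormal (carrier G) {..<m} f" "\<forall>b<m. f b \<in> V"
    and trf: "\<forall>g\<in>carrier G. \<forall>b<m.
      translate G g (f b) = (\<lambda>x. \<Sum>a<m. U g $$ (a, b) * f a x)"
    by (elim exE conjE) (rule that)
  have m: "m > 0" using U by (simp add: irreducible_rep_def)
  have Uc: "U g \<in> carrier_mat m m" if "g \<in> carrier G" for g
    using U(1) that by (auto simp: irreducible_rep_def representation_carrier)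
  \<comment> \<open>This is the matrix, with respect to \<open>F\<close> and \<open>f\<close>, of
    the orthogonal projection onto the span of \<open>f\<close>. The span is invariant and
    translations are unitary, so the projection commutes with them and \<open>P\<close> intertwines
    \<open>\<rho>\<close> and \<open>U\<close>.\<close>
  define P where "P = Matrix.mat m n (\<lambda>(a, j). hermitian_form (carrier G) (F j) (f a))"
  have P_entry: "P $$ (a, j) = hermitian_form (carrier G) (F j) (f a)" if "a < m" "j < n" for a j
    using that by (simp add: P_def)
  have "isomorphic_rep G n \<rho> m U"
  proof (rule schur_isomorphic[OF \<rho> U(1), of P])
    show P: "P \<in> carrier_mat m n" by (simp add: P_def)
    show "P * \<rho> g = U g * P" if g: "g \<in> carrier G" for g
    proof (rule eq_matI)
      fix a j assume "a < dim_row (U g * P)" "j < dim_col (U g * P)"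
      then have aj: "a < m" "j < n" using P Uc[OF g] by auto
      have "(P * \<rho> g) $$ (a, j) = (\<Sum>k<n. \<rho> g $$ (k, j) * hermitian_form (carrier G) (F k) (f a))"
        using aj P \<rho>c[OF g] by (simp add: scalar_prod_def atLeast0LessThan P_entry mult.commute)
      also have "\<dots> = hermitian_form (carrier G) (translate G g (F j)) (f a)"
        by (simp add: trF[OF g aj(2)] hermitian_form_sum_left hermitian_form_scale_left)
      \<comment> \<open>Moving the translation to the second argument replaces \<open>g\<close> by
        \<open>inv g\<close> and conjugates the coefficients; unitarity of \<open>U\<close> undoes
        both in the next step.\<close>
      also have "\<dots> = (\<Sum>b<m. cnj (U (inv g) $$ (b, a)) * hermitian_form (carrier G) (F j) (f b))"
        by (simp add: hermitian_form_translate[OF g] trf[rule_format, OF inv_closed[OF g] aj(1)]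
            hermitian_form_sum_right hermitian_form_scale_right)
      also have "\<dots> = (\<Sum>b<m. U g $$ (a, b) * P $$ (b, j))"
        using U(2) g aj by (simp add: unitary_rep_def P_entry)
      also have "\<dots> = (U g * P) $$ (a, j)"
        using aj P Uc[OF g] by (simp add: scalar_prod_def atLeast0LessThan)
      finally show "(P * \<rho> g) $$ (a, j) = (U g * P) $$ (a, j)" .
    qed (use P Uc[OF g] \<rho>c[OF g] in auto)
    \<comment> \<open>If all entries vanished, \<open>f 0\<close> would be orthogonal to every
      \<open>F j\<close>, and hence to itself, being a combination of them.\<close>
    show "P \<noteq> 0\<^sub>m m n"
    proof
      assume P0: "P = 0\<^sub>m m n"
      have F0: "hermitian_form (carrier G) (F j) (f 0) = 0" if "j < n" for j
        using P_entry[OF m that] that m by (simp add: P0)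
      obtain c where "f 0 = (\<lambda>x. \<Sum>j<n. c j * F j x)" using f(2)[rule_format, OF m] by (auto simp: V_def)
      then have "hermitian_form (carrier G) (f 0) (f 0)
          = hermitian_form (carrier G) (\<lambda>x. \<Sum>j<n. c j * F j x) (f 0)" by simp
      also have "\<dots> = 0" by (simp add: hermitian_form_sum_left hermitian_form_scale_left F0)
      finally show False using f(1) m by (simp add: orthonormal_def)
    qed
  qed
  moreover from this have "m = n" by (simp add: isomorphic_rep_def)
  ultimately show thesis using U by (intro that[of U]) simp_all
qed

end

section \<open>Orthogonality and completeness of the matrix coefficients\<close>

definition matrix_coeff :: "('a, 'b) monoid_scheme \<Rightarrow> ('a \<Rightarrow> complex mat) \<Rightarrow> nat \<Rightarrow> nat \<Rightarrow> 'a \<Rightarrow> complex" where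
  "matrix_coeff G U a b = (\<lambda>g. if g \<in> carrier G then U g $$ (a, b) else 0)"

lemma hermitian_form_matrix_coeff:
  "hermitian_form (carrier G) (matrix_coeff G U a b) (matrix_coeff G U' c e)
    = (\<Sum>g\<in>carrier G. U g $$ (a, b) * cnj (U' g $$ (c, e)))"
  by (simp add: hermitian_form_def matrix_coeff_def)

context finite_group
begin

text \<open>For fixed \<open>b\<close> and \<open>e\<close>, \<open>A\<close> is the averaging sum
  of \<open>U g * E * U' (inv g)\<close> over the group, with \<open>E\<close> the matrix unit at
  \<open>(b, e)\<close>. Reindexing the sum by left multiplication with \<open>h\<close> gives the
  intertwining relation.\<close>

lemma matrix_coeff_gram_intertwines:
  assumes U: "unitary_rep G m U" and U': "unitary_rep G n U'" and be: "b < m" "e < n"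
    and h: "h \<in> carrier G"
    and A: "A = Matrix.mat m n
      (\<lambda>(a, c). hermitian_form (carrier G) (matrix_coeff G U a b) (matrix_coeff G U' c e))"
  shows "A * U' h = U h * A"
proof (rule eq_matI)
  have rep: "representation G m U" "representation G n U'"
    using U U' by (auto simp: unitary_rep_def)
  have c: "U g \<in> carrier_mat m m" "U' g \<in> carrier_mat n n" if "g \<in> carrier G" for g
    using rep that by (auto simp: representation_carrier)
  have Ac: "A \<in> carrier_mat m n" by (simp add: A)
  fix a c assume "a < dim_row (U h * A)" "c < dim_col (U h * A)"
  then have ac: "a < m" "c < n" using c[OF h] Ac by auto
  have "(A * U' h) $$ (a, c) = (\<Sum>f<n. (\<Sum>g\<in>carrier G. U g $$ (a, b) * cnj (U' g $$ (f, e))) * U' h $$ (f, c))"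
    using c[OF h] Ac ac by (simp add: scalar_prod_def atLeast0LessThan A hermitian_form_matrix_coeff)
  also have "\<dots> = (\<Sum>g\<in>carrier G. U g $$ (a, b) * (\<Sum>f<n. cnj (U' g $$ (f, e)) * U' h $$ (f, c)))"
    unfolding sum_distrib_left sum_distrib_right by (subst sum.swap) (simp add: mult_ac)
  \<comment> \<open>By unitarity of \<open>U'\<close> the entry \<open>U' h $$ (f, c)\<close> is the
    conjugate of \<open>U' (inv h) $$ (c, f)\<close>, so the inner sum is a conjugated entry of a
    matrix product.\<close>
  also have "\<dots> = (\<Sum>g\<in>carrier G. U g $$ (a, b) * cnj (U' (inv h \<otimes> g) $$ (c, e)))"
  proof (rule sum.cong[OF refl])
    fix g assume g: "g \<in> carrier G"
    have "U' (inv h \<otimes> g) $$ (c, e) = (\<Sum>f<n. U' (inv h) $$ (c, f) * U' g $$ (f, e))"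
      using representation_mult[OF rep(2) inv_closed[OF h] g] c[OF inv_closed[OF h]] c[OF g] ac be
      by (simp add: scalar_prod_def atLeast0LessThan)
    then have "cnj (U' (inv h \<otimes> g) $$ (c, e)) = (\<Sum>f<n. cnj (U' g $$ (f, e)) * U' h $$ (f, c))"
      using U' h ac by (simp add: unitary_rep_def mult.commute)
    then show "U g $$ (a, b) * (\<Sum>f<n. cnj (U' g $$ (f, e)) * U' h $$ (f, c))
        = U g $$ (a, b) * cnj (U' (inv h \<otimes> g) $$ (c, e))" by simp
  qed
  also have "\<dots> = (\<Sum>g\<in>carrier G. U (h \<otimes> g) $$ (a, b) * cnj (U' g $$ (c, e)))"
    by (rule sum.reindex_bij_witness[of _ "\<lambda>g. h \<otimes> g" "\<lambda>g. inv h \<otimes> g"])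
      (use h in \<open>auto simp: m_assoc[symmetric]\<close>)
  also have "\<dots> = (\<Sum>g\<in>carrier G. (\<Sum>f<m. U h $$ (a, f) * U g $$ (f, b)) * cnj (U' g $$ (c, e)))"
  proof (rule sum.cong[OF refl])
    fix g assume g: "g \<in> carrier G"
    show "U (h \<otimes> g) $$ (a, b) * cnj (U' g $$ (c, e))
        = (\<Sum>f<m. U h $$ (a, f) * U g $$ (f, b)) * cnj (U' g $$ (c, e))"
      using representation_mult[OF rep(1) h g] c[OF h] c[OF g] ac be
      by (simp add: scalar_prod_def atLeast0LessThan)
  qed
  also have "\<dots> = (\<Sum>f<m. U h $$ (a, f) * (\<Sum>g\<in>carrier G. U g $$ (f, b) * cnj (U' g $$ (c, e))))"
    unfolding sum_distrib_left sum_distrib_right by (subst sum.swap) (simp add: mult_ac)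
  also have "\<dots> = (U h * A) $$ (a, c)"
    using c[OF h] Ac ac by (simp add: scalar_prod_def atLeast0LessThan A hermitian_form_matrix_coeff)
  finally show "(A * U' h) $$ (a, c) = (U h * A) $$ (a, c)" .
qed (use U U' h A in \<open>auto simp: unitary_rep_def dest!: representation_carrier\<close>)

lemma schur_orthogonality_distinct:
  assumes "irreducible_rep G m U" "unitary_rep G m U" "irreducible_rep G n U'" "unitary_rep G n U'"
    and "\<not> isomorphic_rep G n U' m U" and ind: "a < m" "b < m" "c < n" "e < n"
  shows "hermitian_form (carrier G) (matrix_coeff G U a b) (matrix_coeff G U' c e) = 0"
proof -
  define A where "A = Matrix.mat m n
    (\<lambda>(a, c). hermitian_form (carrier G) (matrix_coeff G U a b) (matrix_coeff G U' c e))"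
  have "A = 0\<^sub>m m n"
  proof (rule ccontr)
    assume "A \<noteq> 0\<^sub>m m n"
    moreover have "A \<in> carrier_mat m n" by (simp add: A_def)
    moreover have "A * U' g = U g * A" if "g \<in> carrier G" for g
      using assms that by (intro matrix_coeff_gram_intertwines[OF _ _ _ _ _ A_def]) auto
    ultimately have "isomorphic_rep G n U' m U" using assms by (intro schur_isomorphic)
    then show False using assms by simp
  qed
  moreover have "A $$ (a, c)
      = hermitian_form (carrier G) (matrix_coeff G U a b) (matrix_coeff G U' c e)"
    using ind by (simp add: A_def)
  ultimately show ?thesis using ind by simp
qed

text \<open>For fixed \<open>b\<close> and \<open>e\<close> the matrix of forms is a scalar
  \<open>k\<close> by Schur's lemma. Its trace determines \<open>k\<close>: by unitarity, each group
  element contributes the entry at \<open>(e, b)\<close> of \<open>U (inv g) * U g\<close>, which is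
  the identity matrix.\<close>

lemma schur_orthogonality_same:
  assumes irr: "irreducible_rep G n U" and unitary: "unitary_rep G n U"
    and ind: "a < n" "b < n" "c < n" "e < n"
  shows "hermitian_form (carrier G) (matrix_coeff G U a b) (matrix_coeff G U c e)
    = (if a = c \<and> b = e then of_nat (order G) / of_nat n else 0)"
proof -
  have rep: "representation G n U" using unitary by (simp add: unitary_rep_def)
  have Uc: "U g \<in> carrier_mat n n" if "g \<in> carrier G" for g
    using rep that by (rule representation_carrier)
  define A where "A = Matrix.mat n n
    (\<lambda>(a, c). hermitian_form (carrier G) (matrix_coeff G U a b) (matrix_coeff G U c e))"
  have "A * U g = U g * A" if "g \<in> carrier G" for g
    using assms that by (intro matrix_coeff_gram_intertwines[OF _ _ _ _ _ A_def]) auto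
  then obtain k where k: "A = k \<cdot>\<^sub>m 1\<^sub>m n"
    using irr by (elim schur_scalar[of G n U A]) (auto simp: A_def)
  have "of_nat n * k = (\<Sum>a<n. A $$ (a, a))" by (simp add: k)
  also have "\<dots> = (\<Sum>a<n. \<Sum>g\<in>carrier G. U g $$ (a, b) * cnj (U g $$ (a, e)))"
    by (simp add: A_def hermitian_form_matrix_coeff)
  also have "\<dots> = (\<Sum>g\<in>carrier G. \<Sum>a<n. U (inv g) $$ (e, a) * U g $$ (a, b))"
    using unitary ind by (subst sum.swap) (simp add: unitary_rep_def mult.commute)
  also have "\<dots> = (\<Sum>g\<in>carrier G. if e = b then 1 else 0)"
  proof (rule sum.cong[OF refl])
    fix g assume g: "g \<in> carrier G"
    have "(\<Sum>a<n. U (inv g) $$ (e, a) * U g $$ (a, b)) = (U (inv g) * U g) $$ (e, b)"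
      using Uc[OF g] Uc[OF inv_closed[OF g]] ind by (simp add: scalar_prod_def atLeast0LessThan)
    also have "U (inv g) * U g = 1\<^sub>m n"
      using representation_mult[OF rep inv_closed[OF g] g] g representation_one[OF is_group rep] by simp
    finally show "(\<Sum>a<n. U (inv g) $$ (e, a) * U g $$ (a, b)) = (if e = b then 1 else 0)"
      using ind by simp
  qed
  finally have "of_nat n * k = (if e = b then of_nat (order G) else 0)"
    by (simp add: order_def)
  then have "k = (if e = b then of_nat (order G) / of_nat n else 0)"
    using ind by (auto simp: field_simps split: if_splits)
  moreover have "hermitian_form (carrier G) (matrix_coeff G U a b) (matrix_coeff G U c e) = A $$ (a, c)"
    using ind by (simp add: A_def)
  ultimately show ?thesis using ind by (auto simp: k)
qed

text \<open>The dimensions \<open>d\<close> stay the same, so the multiplicities and values in the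
  theorem may be computed from the unitary system.\<close>

lemma unitary_irreducible_reps_system:
  assumes sys: "irreducible_reps_system G s d \<rho>"
  obtains U where "irreducible_reps_system G s d U" "\<And>i. i < s \<Longrightarrow> unitary_rep G (d i) (U i)"
proof -
  have irr: "irreducible_rep G (d i) (\<rho> i)" if "i < s" for i
    using sys that by (simp add: irreducible_reps_system_def)
  have "\<exists>V. irreducible_rep G (d i) V \<and> unitary_rep G (d i) V \<and>
      isomorphic_rep G (d i) (\<rho> i) (d i) V" if "i < s" for i
    using irreducible_rep_unitarizable[OF irr[OF that]] by metis
  then obtain U where U: "\<And>i. i < s \<Longrightarrow> irreducible_rep G (d i) (U i)"
    "\<And>i. i < s \<Longrightarrow> unitary_rep G (d i) (U i)"
    "\<And>i. i < s \<Longrightarrow> isomorphic_rep G (d i) (\<rho> i) (d i) (U i)"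
    by metis
  have rep: "representation G (d i) (\<rho> i)" "representation G (d i) (U i)" if "i < s" for i
    using irr[OF that] U(1)[OF that] by (auto intro: irreducible_rep_representation)
  have "irreducible_reps_system G s d U"
    unfolding irreducible_reps_system_def
  proof (intro conjI allI impI)
    fix i assume "i < s"
    then show "irreducible_rep G (d i) (U i)" by (rule U(1))
  next
    fix i j assume ij: "i < s" "j < s" and iso: "isomorphic_rep G (d i) (U i) (d j) (U j)"
    note i = U(3)[OF ij(1)] rep[OF ij(1)] and j = U(3)[OF ij(2)] rep[OF ij(2)]
    have "isomorphic_rep G (d j) (U j) (d j) (\<rho> j)"
      using j by (rule isomorphic_rep_sym)
    then have "isomorphic_rep G (d i) (U i) (d j) (\<rho> j)"
      by (rule isomorphic_rep_trans[OF iso _ i(3) j(3) j(2)])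
    then have "isomorphic_rep G (d i) (\<rho> i) (d j) (\<rho> j)"
      by (rule isomorphic_rep_trans[OF i(1) _ i(2) i(3) j(2)])
    then show "i = j" using sys ij by (simp add: irreducible_reps_system_def)
  next
    fix n \<tau> assume \<tau>: "irreducible_rep G n \<tau>"
    then have "\<exists>i<s. isomorphic_rep G n \<tau> (d i) (\<rho> i)"
      using sys by (simp add: irreducible_reps_system_def)
    then obtain i where i: "i < s" "isomorphic_rep G n \<tau> (d i) (\<rho> i)" by blast
    have "isomorphic_rep G n \<tau> (d i) (U i)"
      using irreducible_rep_representation[OF \<tau>] i(1)
      by (intro isomorphic_rep_trans[OF i(2) U(3)] rep)
    with i show "\<exists>i<s. isomorphic_rep G n \<tau> (d i) (U i)" by blast
  qed
  with U(2) show thesis by (intro that) auto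
qed

text \<open>The Peter-Weyl theorem for a finite group. A nonzero orthogonal complement
  \<open>V\<close> would contain functions that transform under some irreducible
  \<open>\<tau>\<close>; these are combinations of coefficients of the \<open>U i\<close> isomorphic
  to \<open>\<tau>\<close>, hence orthogonal to themselves.\<close>

lemma matrix_coeffs_complete:
  assumes sys: "irreducible_reps_system G s d U"
    and unitary: "\<And>i. i < s \<Longrightarrow> unitary_rep G (d i) (U i)"
    and v: "v \<in> hilbert_space (carrier G)"
    and orth: "\<And>i a b. i < s \<Longrightarrow> a < d i \<Longrightarrow> b < d i \<Longrightarrow>
      hermitian_form (carrier G) v (matrix_coeff G (U i) a b) = 0"
  shows "v = (\<lambda>_. 0)"
proof (rule ccontr)
  assume nz: "v \<noteq> (\<lambda>_. 0)"
  define V where "V = {v \<in> hilbert_space (carrier G). \<forall>i<s. \<forall>a<d i. \<forall>b<d i.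
    hermitian_form (carrier G) v (matrix_coeff G (U i) a b) = 0}"
  have irr: "irreducible_rep G (d i) (U i)" if "i < s" for i
    using sys that by (simp add: irreducible_reps_system_def)
  have Uc: "U i g \<in> carrier_mat (d i) (d i)" if "i < s" "g \<in> carrier G" for i g
    using irreducible_rep_representation[OF irr[OF that(1)]] that(2) by (rule representation_carrier)
  have vV: "v \<in> V" using v orth by (simp add: V_def)
  have lin: "linear_subspace (carrier G) V"
    unfolding linear_subspace_def V_def
    by (auto simp: hilbert_space_def hermitian_form_scale_left)
      (auto simp: hermitian_form_def distrib_right sum.distrib)
  have inv: "translation_invariant G V"
    unfolding translation_invariant_def
  proof (intro ballI)
    fix h u assume h: "h \<in> carrier G" and u: "u \<in> V"
    have "hermitian_form (carrier G) (translate G h u) (matrix_coeff G (U i) a b) = 0"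
      if i: "i < s" and ab: "a < d i" "b < d i" for i a b
    proof -
      \<comment> \<open>Right translation mixes only the column index, so a translated coefficient
        remains a combination of coefficients of the same \<open>U i\<close>. This is why the
        orthogonal complement is invariant.\<close>
      have "translate G (inv h) (matrix_coeff G (U i) a b)
          = (\<lambda>x. \<Sum>c<d i. U i (inv h) $$ (c, b) * matrix_coeff G (U i) a c x)"
      proof
        fix x
        show "translate G (inv h) (matrix_coeff G (U i) a b) x
          = (\<Sum>c<d i. U i (inv h) $$ (c, b) * matrix_coeff G (U i) a c x)"
        proof (cases "x \<in> carrier G")
          case x: True
          have "U i (x \<otimes> inv h) = U i x * U i (inv h)"
            using irreducible_rep_representation[OF irr[OF i]] x inv_closed[OF h]
            by (rule representation_mult)
          then show ?thesis
            using x h ab Uc[OF i inv_closed[OF h]] Uc[OF i x]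
            by (simp add: translate_def matrix_coeff_def scalar_prod_def atLeast0LessThan mult.commute)
        qed (simp add: translate_def matrix_coeff_def)
      qed
      then show ?thesis using u i ab
        by (simp add: hermitian_form_translate[OF h] hermitian_form_sum_right
            hermitian_form_scale_right V_def)
    qed
    then show "translate G h u \<in> V" by (auto simp: V_def hilbert_space_def translate_def)
  qed
  from irreducible_rep_in_invariant_subspace[OF lin inv vV nz]
  obtain m \<tau> f where \<tau>: "irreducible_rep G m \<tau>" "unitary_rep G m \<tau>"
    and f: "orthonormal (carrier G) {..<m} f" "\<forall>b<m. f b \<in> V"
    and trf: "\<forall>g\<in>carrier G. \<forall>b<m.
      translate G g (f b) = (\<lambda>x. \<Sum>a<m. \<tau> g $$ (a, b) * f a x)"
    by (elim exE conjE) (rule that)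
  have m: "m > 0" using \<tau> by (simp add: irreducible_rep_def)
  obtain i P where i: "i < s" "m = d i" and P: "P \<in> Units (ring_mat TYPE(complex) m ())"
    and P\<tau>: "\<And>g. g \<in> carrier G \<Longrightarrow> P * \<tau> g = U i g * P"
    using sys \<tau>(1) unfolding irreducible_reps_system_def isomorphic_rep_def by metis
  obtain Q where Q: "Q \<in> carrier_mat m m" "Q * P = 1\<^sub>m m" and Pc: "P \<in> carrier_mat m m"
    using P unfolding Units_ring_mat_iff by metis
  \<comment> \<open>evaluating the translates at \<open>\<one>\<close> shows that \<open>f 0\<close> is a combination of coefficients of \<open>\<tau>\<close>\<close>
  have f0: "f 0 x = (\<Sum>a<m. \<Sum>k<m. \<Sum>l<m.
      f a \<one> * Q $$ (a, k) * P $$ (l, 0) * matrix_coeff G (U i) k l x)" for x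
  proof (cases "x \<in> carrier G")
    case x: True
    have \<tau>x: "\<tau> x \<in> carrier_mat m m"
      using irreducible_rep_representation[OF \<tau>(1)] x by (rule representation_carrier)
    have Ux: "U i x \<in> carrier_mat m m" using Uc[OF i(1) x] i(2) by simp
    have "\<tau> x = Q * P * \<tau> x" using Q \<tau>x by simp
    also have "\<dots> = Q * (P * \<tau> x)" using Q Pc \<tau>x by (intro assoc_mult_mat)
    also have "\<dots> = Q * (U i x * P)" by (simp only: P\<tau>[OF x])
    finally have \<tau>_eq: "\<tau> x = Q * (U i x * P)" .
    have "f 0 x = translate G x (f 0) \<one>" using x by (simp add: translate_def)
    also have "\<dots> = (\<Sum>a<m. \<tau> x $$ (a, 0) * f a \<one>)" using trf[rule_format, OF x m] by simp
    also have "\<dots> = (\<Sum>a<m. (\<Sum>k<m. Q $$ (a, k) * (\<Sum>l<m. U i x $$ (k, l) * P $$ (l, 0))) * f a \<one>)"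
      using Q(1) Pc Ux m by (simp add: \<tau>_eq scalar_prod_def atLeast0LessThan)
    finally show ?thesis using x
      by (simp add: matrix_coeff_def sum_distrib_left sum_distrib_right mult_ac)
  next
    case False
    then show ?thesis using f(1) m by (simp add: orthonormal_def hilbert_space_def matrix_coeff_def)
  qed
  \<comment> \<open>Only the second argument is expanded: the first \<open>f 0\<close>, as a member
    of \<open>V\<close>, is orthogonal to each coefficient that appears.\<close>
  have "hermitian_form (carrier G) (f 0) (f 0) = (\<Sum>a<m. \<Sum>k<m. \<Sum>l<m.
      cnj (f a \<one> * Q $$ (a, k) * P $$ (l, 0)) * hermitian_form (carrier G) (f 0) (matrix_coeff G (U i) k l))"
    by (subst (2) f0[abs_def])
      (simp only: hermitian_form_sum_right hermitian_form_scale_right)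
  also have "\<dots> = 0" using f(2)[rule_format, OF m] i by (simp add: V_def)
  finally show False using f(1) m by (simp add: orthonormal_def)
qed

end

section \<open>Uniqueness of the singular values\<close>

lemma tensor_norm_eq_1_iff:
  "tensor_norm d I u = 1 \<longleftrightarrow> tensor_inner d I u u = 1"
proof -
  have "tensor_inner d I u u = of_real (Re (tensor_inner d I u u))"
    unfolding tensor_inner_def hermitian_form_self by simp
  then show ?thesis unfolding tensor_norm_def
    by (metis Re_complex_of_real of_real_1 one_complex.simps(1) real_sqrt_eq_1_iff)
qed

lemma pure_tensor_in_tensor_space: "pure_tensor d I u \<Longrightarrow> u \<in> tensor_space d I"
  unfolding pure_tensor_def tensor_space_def hilbert_space_def
  by (elim exE conjE) (simp add: tensor_prod_def)

lemma tensor_inner_commute: "tensor_inner d I w v = cnj (tensor_inner d I v w)"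
  unfolding tensor_inner_def by (rule hermitian_form_commute)

text \<open>Cauchy-Schwarz, obtained as Bessel's inequality for the one-element family consisting of
  \<open>u\<close>.\<close>

lemma cmod_tensor_inner_le_1:
  assumes "v \<in> tensor_space d I" "tensor_norm d I v = 1" "u \<in> tensor_space d I" "tensor_norm d I u = 1"
  shows "cmod (tensor_inner d I v u) \<le> 1"
proof -
  have "orthonormal (PiE {..<d} I) {()} (\<lambda>_. u)"
    using assms(3,4) by (auto simp: orthonormal_def tensor_norm_eq_1_iff tensor_inner_def tensor_space_def)
  from bessel[OF this, of v] have "(cmod (tensor_inner d I v u))\<^sup>2 \<le> 1"
    using assms(2) by (simp add: tensor_norm_eq_1_iff tensor_inner_def)
  then show ?thesis by (simp add: power_le_one_iff abs_square_le_1)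
qed

definition unit_pure_tensors :: "nat \<Rightarrow> (nat \<Rightarrow> 'a set) \<Rightarrow> 'a tensor set" where
  "unit_pure_tensors d I = {u. pure_tensor d I u \<and> tensor_norm d I u = 1}"

text \<open>The exponent is 1, so the powers in \<open>bracket\<close> disappear. For a nonempty
  tuple of unit pure tensors the supremum is at least 1, as the choice \<open>u = S ! 0\<close>
  shows, and only the upper bound remains to be checked.\<close>

lemma t_orthogonal_2_iff:
  assumes "S \<noteq> []" "\<forall>T\<in>set S. pure_tensor d I T"
  shows "t_orthogonal d I 2 S \<longleftrightarrow> (\<forall>T\<in>set S. tensor_norm d I T = 1) \<and>
    (\<forall>u\<in>unit_pure_tensors d I. (\<Sum>i<length S. cmod (tensor_inner d I (S ! i) u)) \<le> 1)"
proof (cases "\<forall>T\<in>set S. tensor_norm d I T = 1")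
  case True
  let ?f = "\<lambda>u. \<Sum>i<length S. cmod (tensor_inner d I (S ! i) u)"
  have "bracket d I (2 / 2) S = (SUP u\<in>unit_pure_tensors d I. ?f u)"
    unfolding bracket_def unit_pure_tensors_def by (simp add: sum_nonneg)
  moreover have S: "\<forall>T\<in>set S. T \<in> tensor_space d I"
    using assms(2) pure_tensor_in_tensor_space by blast
  ultimately have "t_orthogonal d I 2 S \<longleftrightarrow> (SUP u\<in>unit_pure_tensors d I. ?f u) = 1"
    using True unfolding t_orthogonal_def by simp
  also have "\<dots> \<longleftrightarrow> (\<forall>u\<in>unit_pure_tensors d I. ?f u \<le> 1)"
  proof
    assume sup: "(SUP u\<in>unit_pure_tensors d I. ?f u) = 1"
    \<comment> \<open>A real supremum says something about the individual values only for a bounded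
      set; each summand is at most 1 by Cauchy-Schwarz, hence the crude bound
      \<open>length S\<close>.\<close>
    have "bdd_above (?f ` unit_pure_tensors d I)"
    proof (rule bdd_aboveI2)
      fix u assume "u \<in> unit_pure_tensors d I"
      then have "?f u \<le> (\<Sum>i<length S. 1)"
        using True S by (intro sum_mono cmod_tensor_inner_le_1)
          (auto simp: unit_pure_tensors_def pure_tensor_in_tensor_space)
      then show "?f u \<le> real (length S)" by simp
    qed
    then show "\<forall>u\<in>unit_pure_tensors d I. ?f u \<le> 1"
      unfolding sup[symmetric] by (intro ballI cSUP_upper)
  next
    assume le: "\<forall>u\<in>unit_pure_tensors d I. ?f u \<le> 1"
    have S0: "S ! 0 \<in> unit_pure_tensors d I"
      using assms True by (auto simp: unit_pure_tensors_def)
    show "(SUP u\<in>unit_pure_tensors d I. ?f u) = 1"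
    proof (rule antisym)
      show "(SUP u\<in>unit_pure_tensors d I. ?f u) \<le> 1"
        using S0 le by (intro cSUP_least) auto
      have "1 = cmod (tensor_inner d I (S ! 0) (S ! 0))"
        using S0 by (simp add: unit_pure_tensors_def tensor_norm_eq_1_iff)
      also have "\<dots> \<le> ?f (S ! 0)"
        using assms(1) by (intro member_le_sum[where f = "\<lambda>i. cmod (tensor_inner d I (S ! i) (S ! 0))"]) auto
      also have "\<dots> \<le> (SUP u\<in>unit_pure_tensors d I. ?f u)"
        using S0 le by (intro cSUP_upper bdd_aboveI2) auto
      finally show "1 \<le> (SUP u\<in>unit_pure_tensors d I. ?f u)" .
    qed
  qed
  finally show ?thesis using True by simp
qed (auto simp: t_orthogonal_def)

lemma diagonal_svd_sum_le_1:
  assumes svd: "diagonal_svd d I T \<sigma> v" and u: "u \<in> unit_pure_tensors d I"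
  shows "(\<Sum>i<length v. cmod (tensor_inner d I (v ! i) u)) \<le> 1"
proof (cases "v = []")
  case False
  then show ?thesis using svd u t_orthogonal_2_iff[of v d I] by (auto simp: diagonal_svd_def)
qed simp

lemma diagonal_svd_unit:
  "diagonal_svd d I T \<sigma> v \<Longrightarrow> i < length v \<Longrightarrow> v ! i \<in> unit_pure_tensors d I"
  by (auto simp: diagonal_svd_def unit_pure_tensors_def t_orthogonal_def)

text \<open>The bound is tested on \<open>u = v ! j\<close>: the term with index \<open>j\<close>
  alone already contributes 1, which leaves 0 for all others.\<close>

lemma diagonal_svd_orthonormal:
  assumes svd: "diagonal_svd d I T \<sigma> v" and ij: "i < length v" "j < length v"
  shows "tensor_inner d I (v ! i) (v ! j) = (if i = j then 1 else 0)"
proof (cases "i = j")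
  case True
  then show ?thesis using diagonal_svd_unit[OF svd ij(1)]
    by (simp add: unit_pure_tensors_def tensor_norm_eq_1_iff)
next
  case False
  let ?a = "\<lambda>k. cmod (tensor_inner d I (v ! k) (v ! j))"
  have "?a j = 1" using diagonal_svd_unit[OF svd ij(2)]
    by (simp add: unit_pure_tensors_def tensor_norm_eq_1_iff)
  moreover have "sum ?a {i, j} \<le> sum ?a {..<length v}"
    using ij by (intro sum_mono2) auto
  moreover have "sum ?a {..<length v} \<le> 1"
    using svd diagonal_svd_unit[OF svd ij(2)] by (rule diagonal_svd_sum_le_1)
  moreover have "sum ?a {i, j} = ?a i + ?a j" using False by simp
  ultimately have "?a i \<le> 0" by linarith
  then show ?thesis using False by simp
qed

lemma diagonal_svd_inner:
  assumes "diagonal_svd d I T \<sigma> v"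
  shows "tensor_inner d I T u = (\<Sum>i<length v. of_real (\<sigma> ! i) * tensor_inner d I (v ! i) u)"
proof -
  have T: "T = (\<lambda>x. \<Sum>i<length v. complex_of_real (\<sigma> ! i) * (v ! i) x)"
    using assms unfolding diagonal_svd_def by blast
  show ?thesis
    unfolding tensor_inner_def by (subst T) (simp only: hermitian_form_sum_left hermitian_form_scale_left)
qed

text \<open>
  The left-hand side is at most the pairing of \<open>T\<close> with the sum of the \<open>v ! i\<close> for which
  \<open>\<sigma> ! i > y\<close>, minus \<open>y\<close> times their number.
\<close>

lemma diagonal_svd_excess_le:
  assumes v: "diagonal_svd d I T \<sigma> v" and w: "diagonal_svd d I T \<tau> w" and "y \<ge> 0"
  shows "(\<Sum>x\<leftarrow>\<sigma>. max 0 (x - y)) \<le> (\<Sum>x\<leftarrow>\<tau>. max 0 (x - y))"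
proof -
  have len: "length \<sigma> = length v" "length \<tau> = length w" using v w by (auto simp: diagonal_svd_def)
  have \<tau>_pos: "\<tau> ! j > 0" if "j < length w" for j
    using w that by (auto simp: diagonal_svd_def)
  define S where "S = {i. i < length v \<and> \<sigma> ! i > y}"
  have S: "finite S" "S \<subseteq> {..<length v}" by (auto simp: S_def)
  \<comment> \<open>Sums of \<open>a j i\<close> over \<open>i\<close> are at most 1 by the bound
    for \<open>v\<close> tested on \<open>w ! j\<close>, and sums over \<open>j\<close> are at most
    1 by the bound for \<open>w\<close> tested on \<open>v ! i\<close>. Both tests are legitimate
    because all these vectors are pure.\<close>
  define a where "a = (\<lambda>j i. cmod (tensor_inner d I (w ! j) (v ! i)))"
  define A where "A = (\<lambda>j. \<Sum>i\<in>S. a j i)"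
  have A_nonneg: "0 \<le> A j" for j by (simp add: A_def a_def sum_nonneg)
  have A_le: "A j \<le> 1" if "j < length w" for j
  proof -
    have "A j \<le> (\<Sum>i<length v. cmod (tensor_inner d I (v ! i) (w ! j)))"
      unfolding A_def a_def using S
      by (subst tensor_inner_commute) (auto intro!: sum_mono2)
    also have "\<dots> \<le> 1" using v diagonal_svd_unit[OF w that] by (rule diagonal_svd_sum_le_1)
    finally show ?thesis .
  qed
  have sum_A: "(\<Sum>j<length w. A j) \<le> real (card S)"
  proof -
    have "(\<Sum>j<length w. A j) = (\<Sum>i\<in>S. \<Sum>j<length w. a j i)"
      unfolding A_def by (rule sum.swap)
    also have "\<dots> \<le> (\<Sum>i\<in>S. 1)"
      unfolding a_def using w diagonal_svd_unit[OF v] S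
      by (intro sum_mono diagonal_svd_sum_le_1) auto
    finally show ?thesis by simp
  qed
  have "(\<Sum>x\<leftarrow>\<sigma>. max 0 (x - y)) = (\<Sum>i<length v. max 0 (\<sigma> ! i - y))"
    by (simp add: sum_list_sum_nth len atLeast0LessThan)
  also have "\<dots> = (\<Sum>i\<in>S. \<sigma> ! i - y)"
    by (rule sum.mono_neutral_cong_right) (auto simp: S_def)
  also have "\<dots> = (\<Sum>i\<in>S. \<sigma> ! i) - y * card S" by (simp add: sum_subtractf)
  \<comment> \<open>Pairing \<open>T\<close> with \<open>v ! i\<close> returns
    \<open>\<sigma> ! i\<close> by orthonormality of \<open>v\<close>; the same pairing is estimated
    through the other decomposition.\<close>
  also have "(\<Sum>i\<in>S. \<sigma> ! i) \<le> (\<Sum>i\<in>S. \<Sum>j<length w. \<tau> ! j * a j i)"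
  proof (rule sum_mono)
    fix i assume "i \<in> S"
    then have i: "i < length v" by (simp add: S_def)
    have "tensor_inner d I T (v ! i) = (\<Sum>k<length v. if k = i then of_real (\<sigma> ! i) else 0)"
      unfolding diagonal_svd_inner[OF v]
      using i by (intro sum.cong) (auto simp: diagonal_svd_orthonormal[OF v])
    then have "\<sigma> ! i = Re (tensor_inner d I T (v ! i))" using i by simp
    also have "\<dots> = (\<Sum>j<length w. \<tau> ! j * Re (tensor_inner d I (w ! j) (v ! i)))"
      by (simp add: diagonal_svd_inner[OF w])
    also have "\<dots> \<le> (\<Sum>j<length w. \<tau> ! j * a j i)"
      unfolding a_def using \<tau>_pos
      by (intro sum_mono mult_left_mono complex_Re_le_cmod) (auto intro: less_imp_le)
    finally show "\<sigma> ! i \<le> (\<Sum>j<length w. \<tau> ! j * a j i)" .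
  qed
  also have "(\<Sum>i\<in>S. \<Sum>j<length w. \<tau> ! j * a j i) = (\<Sum>j<length w. \<tau> ! j * A j)"
    unfolding A_def sum_distrib_left by (rule sum.swap)
  \<comment> \<open>As \<open>A j\<close> lies between 0 and 1, the product
    \<open>(\<tau> ! j - y) * A j\<close> is at most the positive part of
    \<open>\<tau> ! j - y\<close>. The remaining \<open>y * A j\<close> sums to at most
    \<open>y * card S\<close>, which is the amount subtracted on the side of
    \<open>\<sigma>\<close>.\<close>
  also have "\<dots> \<le> (\<Sum>j<length w. max 0 (\<tau> ! j - y) + y * A j)"
  proof (rule sum_mono)
    fix j assume "j \<in> {..<length w}"
    then have A1: "A j \<le> 1" by (intro A_le) simp
    have "(\<tau> ! j - y) * A j \<le> max 0 (\<tau> ! j - y) * A j"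
      using A_nonneg by (intro mult_right_mono) auto
    also have "\<dots> \<le> max 0 (\<tau> ! j - y)"
      using A1 by (intro mult_left_le) auto
    finally show "\<tau> ! j * A j \<le> max 0 (\<tau> ! j - y) + y * A j" by (simp add: left_diff_distrib)
  qed
  also have "\<dots> = (\<Sum>j<length w. max 0 (\<tau> ! j - y)) + y * (\<Sum>j<length w. A j)"
    by (simp add: sum.distrib sum_distrib_left)
  also have "\<dots> \<le> (\<Sum>j<length w. max 0 (\<tau> ! j - y)) + y * card S"
    using sum_A \<open>y \<ge> 0\<close> by (intro add_left_mono mult_left_mono)
  also have "(\<Sum>j<length w. max 0 (\<tau> ! j - y)) = (\<Sum>x\<leftarrow>\<tau>. max 0 (x - y))"
    by (simp add: sum_list_sum_nth len atLeast0LessThan)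
  finally show ?thesis by simp
qed

text \<open>The multiplicity of \<open>c\<close> is the second difference at \<open>c\<close> of the excess function.\<close>

lemma excess_second_difference:
  fixes xs :: "real list"
  assumes "h > 0" "\<forall>x\<in>set xs. x = c \<or> h \<le> \<bar>x - c\<bar>"
  shows "(\<Sum>x\<leftarrow>xs. max 0 (x - (c - h))) + (\<Sum>x\<leftarrow>xs. max 0 (x - (c + h)))
    - 2 * (\<Sum>x\<leftarrow>xs. max 0 (x - c)) = h * real (count (mset xs) c)"
  using assms(2)
proof (induction xs)
  case (Cons x xs)
  have "max 0 (x - (c - h)) + max 0 (x - (c + h)) - 2 * max 0 (x - c) = (if x = c then h else 0)"
    using Cons.prems assms(1) by (auto simp: max_def abs_if split: if_splits)
  with Cons show ?case by (auto simp: algebra_simps)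
qed simp

lemma mset_eq_if_excess_eq:
  fixes xs ys :: "real list"
  assumes pos: "\<forall>x\<in>set xs. x > 0" "\<forall>x\<in>set ys. x > 0"
    and excess: "\<And>y. y \<ge> 0 \<Longrightarrow> (\<Sum>x\<leftarrow>xs. max 0 (x - y)) = (\<Sum>x\<leftarrow>ys. max 0 (x - y))"
  shows "mset xs = mset ys"
proof (rule multiset_eqI)
  fix c
  show "count (mset xs) c = count (mset ys) c"
  proof (cases "c > 0")
    case True
    \<comment> \<open>The step width \<open>h\<close> must not exceed the distance from
      \<open>c\<close> to any other entry. Including \<open>c\<close> itself gives
      \<open>h \<le> c\<close>, so that \<open>c - h\<close> is still a point where the excess sums
      are known to agree.\<close>
    define D where "D = insert c ((\<lambda>x. \<bar>x - c\<bar>) ` ((set xs \<union> set ys) - {c}))"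
    have D: "finite D" "D \<noteq> {}" "\<forall>x\<in>D. x > 0" using True by (auto simp: D_def)
    define h where "h = Min D"
    have h: "h > 0" using D by (simp add: h_def)
    have "h \<le> c" unfolding h_def by (rule Min_le) (auto simp: D_def)
    have hx: "x = c \<or> h \<le> \<bar>x - c\<bar>" if "x \<in> set xs \<union> set ys" for x
      using that D(1) unfolding h_def by (auto simp: D_def intro!: Min_le)
    have "h * real (count (mset xs) c) = h * real (count (mset ys) c)"
      using h hx True \<open>h \<le> c\<close>
      by (simp add: excess_second_difference[symmetric] excess)
    then show ?thesis using h by simp
  next
    case False
    then show ?thesis using pos by (metis count_mset_0_iff less_le)
  qed
qed

lemma diagonal_svd_unique:
  assumes "diagonal_svd d I T \<sigma> v" "diagonal_svd d I T \<tau> w"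
  shows "mset \<sigma> = mset \<tau>"
  using assms
  by (intro mset_eq_if_excess_eq antisym diagonal_svd_excess_le[of d I T])
    (auto simp: diagonal_svd_def)

section \<open>The decomposition of the group algebra tensor\<close>

lemma prod_lessThan_3: "(\<Prod>e<3::nat. f e) = f 0 * f 1 * (f 2 :: 'b :: comm_monoid_mult)"
  by (simp add: numeral_3_eq_3 numeral_2_eq_2 lessThan_Suc mult_ac)

lemma tensor_prod_3:
  "tensor_prod 3 I v x = (if x \<in> PiE {..<3} I then v 0 (x 0) * v 1 (x 1) * v 2 (x 2) else 0)"
  unfolding tensor_prod_def prod_lessThan_3 ..

lemma PiE_lessThan_3:
  fixes x :: "nat \<Rightarrow> 'a"
  assumes "x \<in> PiE {..<3} (\<lambda>_. A)"
  shows "x 0 \<in> A" "x 1 \<in> A" "x 2 \<in> A"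
  using PiE_mem[OF assms, of 0] PiE_mem[OF assms, of 1] PiE_mem[OF assms, of 2] by simp_all

lemma group_tensor_eq:
  assumes "finite (carrier G)"
  shows "group_tensor G x = (if x \<in> PiE {..<3} (\<lambda>_. carrier G) \<and>
    x 0 \<otimes>\<^bsub>G\<^esub> x 1 \<otimes>\<^bsub>G\<^esub> x 2 = \<one>\<^bsub>G\<^esub> then 1 else 0)"
proof -
  let ?S = "{(g, h, k). g \<in> carrier G \<and> h \<in> carrier G \<and> k \<in> carrier G \<and>
    g \<otimes>\<^bsub>G\<^esub> h \<otimes>\<^bsub>G\<^esub> k = \<one>\<^bsub>G\<^esub>}"
  let ?t = "\<lambda>(g, h, k). tensor_prod 3 (\<lambda>_. carrier G) (\<lambda>e. basis_vec ([g, h, k] ! e)) x"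
  have S: "finite ?S"
    by (rule finite_subset[of _ "carrier G \<times> carrier G \<times> carrier G"]) (use assms in auto)
  show ?thesis
  proof (cases "x \<in> PiE {..<3} (\<lambda>_. carrier G)")
    case True
    note x = PiE_lessThan_3[OF True]
    have "?t p = (if p = (x 0, x 1, x 2) then 1 else 0)" for p
    proof -
      obtain g h k where p: "p = (g, h, k)" by (cases p)
      show ?thesis unfolding p prod.case tensor_prod_3 if_P[OF True] basis_vec_def by auto
    qed
    then have "group_tensor G x = (\<Sum>p\<in>?S. if p = (x 0, x 1, x 2) then 1 else 0)"
      unfolding group_tensor_def by (intro sum.cong) auto
    then have "group_tensor G x = (if (x 0, x 1, x 2) \<in> ?S then 1 else 0)"
      using S by simp
    then show ?thesis by (simp only: True simp_thms mem_Collect_eq prod.case x)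
  next
    case False
    then have "?t p = 0" for p by (cases p) (simp only: tensor_prod_3 prod.case if_False)
    then have "group_tensor G x = 0" unfolding group_tensor_def by (intro sum.neutral) auto
    then show ?thesis by (simp only: False simp_thms if_False)
  qed
qed

text \<open>The left-hand side is the sum of the traces of \<open>X i * Y i * Z i\<close>, the
  right-hand side a product of Frobenius norms taken over all blocks. Cauchy-Schwarz over
  \<open>(i, a, c)\<close> separates \<open>Z\<close>, and Cauchy-Schwarz over \<open>b\<close> is
  the submultiplicativity of the Frobenius norm for \<open>M i\<close>.\<close>

lemma cyclic_sum_le:
  fixes X Y Z :: "nat \<Rightarrow> nat \<Rightarrow> nat \<Rightarrow> real"
  shows "(\<Sum>i<s. \<Sum>a<d i. \<Sum>b<d i. \<Sum>c<d i. X i a b * Y i b c * Z i c a)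
    \<le> sqrt (\<Sum>i<s. \<Sum>a<d i. \<Sum>b<d i. (X i a b)\<^sup>2) * sqrt (\<Sum>i<s. \<Sum>a<d i. \<Sum>b<d i. (Y i a b)\<^sup>2)
      * sqrt (\<Sum>i<s. \<Sum>a<d i. \<Sum>b<d i. (Z i a b)\<^sup>2)"
proof -
  define J where "J = (SIGMA i:{..<s}. {..<d i} \<times> {..<d i})"
  define M where "M = (\<lambda>i a c. \<Sum>b<d i. X i a b * Y i b c)"
  define P Q where "P = (\<lambda>i. \<Sum>a<d i. \<Sum>b<d i. (X i a b)\<^sup>2)"
    and "Q = (\<lambda>i. \<Sum>a<d i. \<Sum>b<d i. (Y i a b)\<^sup>2)"
  have P: "P i \<ge> 0" and Q: "Q i \<ge> 0" for i by (auto simp: P_def Q_def intro!: sum_nonneg)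
  have J_sum: "(\<Sum>(i, a, c)\<in>J. f i a c) = (\<Sum>i<s. \<Sum>a<d i. \<Sum>c<d i. f i a c)" for f :: "nat \<Rightarrow> nat \<Rightarrow> nat \<Rightarrow> real"
    unfolding J_def by (simp add: sum.Sigma sum.cartesian_product)
  have "(\<Sum>i<s. \<Sum>a<d i. \<Sum>b<d i. \<Sum>c<d i. X i a b * Y i b c * Z i c a)
      = (\<Sum>i<s. \<Sum>a<d i. \<Sum>c<d i. M i a c * Z i c a)"
    unfolding M_def sum_distrib_right by (intro sum.cong refl sum.swap)
  also have "\<dots> = (\<Sum>(i, a, c)\<in>J. M i a c * Z i c a)" by (rule J_sum[symmetric])
  also have "\<dots> \<le> (\<Sum>p\<in>J. \<bar>case p of (i, a, c) \<Rightarrow> M i a c\<bar> * \<bar>case p of (i, a, c) \<Rightarrow> Z i c a\<bar>)"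
    by (intro sum_mono) (auto simp: abs_mult[symmetric])
  also have "\<dots> \<le> L2_set (\<lambda>(i, a, c). M i a c) J * L2_set (\<lambda>(i, a, c). Z i c a) J"
    by (rule L2_set_mult_ineq)
  also have "L2_set (\<lambda>(i, a, c). Z i c a) J = sqrt (\<Sum>i<s. \<Sum>a<d i. \<Sum>b<d i. (Z i a b)\<^sup>2)"
  proof -
    have "(\<Sum>p\<in>J. (case p of (i, a, c) \<Rightarrow> Z i c a)\<^sup>2) = (\<Sum>(i, a, c)\<in>J. (Z i c a)\<^sup>2)"
      by (intro sum.cong) auto
    also have "\<dots> = (\<Sum>i<s. \<Sum>a<d i. \<Sum>b<d i. (Z i a b)\<^sup>2)"
      unfolding J_sum by (intro sum.cong refl sum.swap)
    finally show ?thesis by (simp add: L2_set_def)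
  qed
  also have "L2_set (\<lambda>(i, a, c). M i a c) J \<le> sqrt ((\<Sum>i<s. P i) * (\<Sum>i<s. Q i))"
  proof -
    have "(\<Sum>p\<in>J. (case p of (i, a, c) \<Rightarrow> M i a c)\<^sup>2) = (\<Sum>(i, a, c)\<in>J. (M i a c)\<^sup>2)"
      by (intro sum.cong) auto
    also have "\<dots> = (\<Sum>i<s. \<Sum>a<d i. \<Sum>c<d i. (M i a c)\<^sup>2)" by (rule J_sum)
    also have "\<dots> \<le> (\<Sum>i<s. \<Sum>a<d i. \<Sum>c<d i. (\<Sum>b<d i. (X i a b)\<^sup>2) * (\<Sum>b<d i. (Y i b c)\<^sup>2))"
      unfolding M_def by (intro sum_mono Cauchy_Schwarz_ineq_sum)
    also have "\<dots> = (\<Sum>i<s. P i * (\<Sum>c<d i. \<Sum>b<d i. (Y i b c)\<^sup>2))"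
      unfolding P_def sum_product ..
    also have "\<dots> = (\<Sum>i<s. P i * Q i)"
      unfolding Q_def by (intro sum.cong refl arg_cong2[where f = "(*)"] sum.swap)
    \<comment> \<open>Passing from single blocks to all blocks: each nonnegative \<open>Q i\<close>
      is enlarged to the total sum.\<close>
    also have "\<dots> \<le> (\<Sum>i<s. P i * (\<Sum>i<s. Q i))"
      using P Q by (intro sum_mono mult_left_mono member_le_sum) auto
    finally show ?thesis by (simp add: L2_set_def sum_distrib_right)
  qed
  finally show ?thesis
    by (simp add: P_def Q_def real_sqrt_mult mult_right_mono sum_nonneg)
qed

lemma sum_singleton_mset_const: "finite A \<Longrightarrow> (\<Sum>x\<in>A. {#c#}) = replicate_mset (card A) c"
  by (induction A rule: finite_induct) auto

lemma sum_nth_distinct: "distinct xs \<Longrightarrow> (\<Sum>i<length xs. f (xs ! i)) = sum f (set xs)"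
  by (simp add: sum.distinct_set_conv_list sum_list_sum_nth atLeast0LessThan)

section \<open>The orthonormal basis of normalized matrix coefficients\<close>

locale unitary_irreps = finite_group G for G :: "('a, 'b) monoid_scheme" (structure) +
  fixes s :: nat and d :: "nat \<Rightarrow> nat" and U :: "nat \<Rightarrow> 'a \<Rightarrow> complex mat"
  assumes sys: "irreducible_reps_system G s d U"
    and unitary: "i < s \<Longrightarrow> unitary_rep G (d i) (U i)"
begin

lemma U_irreducible: "i < s \<Longrightarrow> irreducible_rep G (d i) (U i)"
  using sys by (simp add: irreducible_reps_system_def)

lemma U_representation: "i < s \<Longrightarrow> representation G (d i) (U i)"
  using unitary by (simp add: unitary_rep_def)

lemma U_carrier: "i < s \<Longrightarrow> g \<in> carrier G \<Longrightarrow> U i g \<in> carrier_mat (d i) (d i)"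
  using U_representation by (rule representation_carrier)

lemma d_pos: "i < s \<Longrightarrow> d i > 0"
  using U_irreducible by (simp add: irreducible_rep_def)

lemma order_pos: "order G > 0"
  using finite_carrier by (simp add: order_gt_0_iff_finite)

definition coeff_basis :: "nat \<times> nat \<times> nat \<Rightarrow> 'a \<Rightarrow> complex" where
  "coeff_basis = (\<lambda>(i, a, b) x. of_real (sqrt (d i / order G)) * matrix_coeff G (U i) a b x)"

definition coeff_index :: "(nat \<times> nat \<times> nat) set" where
  "coeff_index = (SIGMA i:{..<s}. {..<d i} \<times> {..<d i})"

lemma sum_coeff_index:
  "(\<Sum>p\<in>coeff_index. f p) = (\<Sum>i<s. \<Sum>a<d i. \<Sum>b<d i. f (i, a, b))"
  unfolding coeff_index_def by (simp add: sum.Sigma sum.cartesian_product)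

lemma coeff_basis_hilbert_space: "coeff_basis p \<in> hilbert_space (carrier G)"
  by (simp add: coeff_basis_def matrix_coeff_def hilbert_space_def split: prod.splits)

lemma orthonormal_coeff_basis: "orthonormal (carrier G) coeff_index coeff_basis"
  unfolding orthonormal_def
proof (intro conjI ballI coeff_basis_hilbert_space)
  show "finite coeff_index" by (simp add: coeff_index_def)
  fix p q assume "p \<in> coeff_index" "q \<in> coeff_index"
  then obtain i a b j c e where p: "p = (i, a, b)" "i < s" "a < d i" "b < d i"
    and q: "q = (j, c, e)" "j < s" "c < d j" "e < d j"
    by (auto simp: coeff_index_def)
  have form: "hermitian_form (carrier G) (coeff_basis p) (coeff_basis q)
      = of_real (sqrt (d i / order G)) * (of_real (sqrt (d j / order G)) *
        hermitian_form (carrier G) (matrix_coeff G (U i) a b) (matrix_coeff G (U j) c e))"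
    unfolding p q coeff_basis_def by (simp add: hermitian_form_scale_left hermitian_form_scale_right)
  show "hermitian_form (carrier G) (coeff_basis p) (coeff_basis q) = (if p = q then 1 else 0)"
  proof (cases "i = j")
    case True
    define r k where "r = complex_of_real (sqrt (d i / order G))"
      and "k = (of_nat (order G) / of_nat (d i) :: complex)"
    have "r * (r * k) = of_real (sqrt (d i / order G) * sqrt (d i / order G) * (order G / d i))"
      by (simp only: r_def k_def of_real_mult of_real_divide of_real_of_nat_eq mult.assoc)
    also have "sqrt (d i / order G) * sqrt (d i / order G) * (order G / d i) = 1"
      using d_pos[OF p(2)] order_pos by simp
    finally have rk: "r * (r * k) = 1" by simp
    have "hermitian_form (carrier G) (matrix_coeff G (U i) a b) (matrix_coeff G (U j) c e)
        = (if a = c \<and> b = e then k else 0)"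
      unfolding k_def True[symmetric] using p q True U_irreducible unitary
      by (intro schur_orthogonality_same) auto
    then have "hermitian_form (carrier G) (coeff_basis p) (coeff_basis q)
        = r * (r * (if a = c \<and> b = e then k else 0))"
      unfolding form True[symmetric] r_def by simp
    then show ?thesis using True p q rk by auto
  next
    case False
    then have "\<not> isomorphic_rep G (d j) (U j) (d i) (U i)"
      using sys p q unfolding irreducible_reps_system_def by blast
    then have "hermitian_form (carrier G) (matrix_coeff G (U i) a b) (matrix_coeff G (U j) c e) = 0"
      using p q U_irreducible unitary by (intro schur_orthogonality_distinct)
    then show ?thesis using False p q unfolding form by simp
  qed
qed

text \<open>The residual is orthogonal to every basis function, hence to every matrix coefficient
  since the normalizing factors are nonzero, and completeness makes it vanish.\<close>

lemma expansion_coeff_basis: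
  assumes "v \<in> hilbert_space (carrier G)"
  shows "expansion (carrier G) coeff_index coeff_basis v = v"
proof -
  let ?r = "\<lambda>x. v x - expansion (carrier G) coeff_index coeff_basis v x"
  have "?r = (\<lambda>_. 0)"
  proof (rule matrix_coeffs_complete[OF sys unitary])
    show "?r \<in> hilbert_space (carrier G)"
      using assms coeff_basis_hilbert_space by (auto simp: hilbert_space_def expansion_def)
    fix i a b assume i: "i < s" and ab: "a < d i" "b < d i"
    then have "(i, a, b) \<in> coeff_index" by (simp add: coeff_index_def)
    from hermitian_form_residual[OF orthonormal_coeff_basis this, of v]
    show "hermitian_form (carrier G) ?r (matrix_coeff G (U i) a b) = 0"
      using d_pos[OF i] order_pos by (simp add: coeff_basis_def hermitian_form_scale_right)
  qed
  then show ?thesis by (intro ext) (metis eq_iff_diff_eq_0)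
qed

text \<open>This is the decomposition of the regular character, divided by the group order. At the
  neutral element the coefficients form an identity matrix, so only the diagonal functions enter the
  expansion of \<open>basis_vec \<one>\<close>.\<close>

lemma sum_characters:
  assumes x: "x \<in> carrier G"
  shows "(\<Sum>i<s. of_real (d i / order G) * (\<Sum>a<d i. U i x $$ (a, a))) = (if x = \<one> then 1 else 0)"
proof -
  have "basis_vec \<one> x = expansion (carrier G) coeff_index coeff_basis (basis_vec \<one>) x"
    by (subst expansion_coeff_basis) (auto simp: hilbert_space_def basis_vec_def)
  also have "\<dots> = (\<Sum>p\<in>coeff_index. cnj (coeff_basis p \<one>) * coeff_basis p x)"
    unfolding expansion_def using finite_carrier by (simp add: hermitian_form_basis_vec)
  also have "\<dots> = (\<Sum>i<s. \<Sum>a<d i. \<Sum>b<d i. if b = a then of_real (d i / order G) * U i x $$ (a, a) else 0)"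
    unfolding sum_coeff_index
  proof (intro sum.cong refl)
    fix i a b assume "i \<in> {..<s}" "a \<in> {..<d i}" "b \<in> {..<d i}"
    moreover have "complex_of_real (sqrt (d i / order G)) * of_real (sqrt (d i / order G)) = of_real (d i / order G)"
      unfolding of_real_mult[symmetric] by simp
    ultimately show "cnj (coeff_basis (i, a, b) \<one>) * coeff_basis (i, a, b) x
        = (if b = a then of_real (d i / order G) * U i x $$ (a, a) else 0)"
      using x representation_one[OF is_group U_representation, of i]
      by (auto simp: coeff_basis_def matrix_coeff_def mult.assoc[symmetric])
  qed
  also have "\<dots> = (\<Sum>i<s. of_real (d i / order G) * (\<Sum>a<d i. U i x $$ (a, a)))"
    by (simp add: sum_distrib_left)
  finally show ?thesis by (simp add: basis_vec_def)
qed

section \<open>The singular vectors and singular values of the tensor\<close>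

definition svd_index :: "(nat \<times> nat \<times> nat \<times> nat) set" where
  "svd_index = (SIGMA i:{..<s}. {..<d i} \<times> {..<d i} \<times> {..<d i})"

definition svd_vector :: "nat \<times> nat \<times> nat \<times> nat \<Rightarrow> 'a tensor" where
  "svd_vector = (\<lambda>(i, a, b, c). tensor_prod 3 (\<lambda>_. carrier G)
    (\<lambda>e. coeff_basis ([(i, a, b), (i, b, c), (i, c, a)] ! e)))"

definition svd_value :: "nat \<times> nat \<times> nat \<times> nat \<Rightarrow> real" where
  "svd_value = (\<lambda>(i, _). sqrt (order G / d i))"

lemma finite_svd_index: "finite svd_index" by (simp add: svd_index_def)

lemma sum_svd_index:
  "(\<Sum>p\<in>svd_index. f p) = (\<Sum>i<s. \<Sum>a<d i. \<Sum>b<d i. \<Sum>c<d i. f (i, a, b, c))"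
  unfolding svd_index_def by (simp add: sum.Sigma sum.cartesian_product)

text \<open>Without any irreducible representation the character sum at the neutral element would be
  empty, yet it equals 1. The reduction of 2-orthogonality to an upper bound relies on a nonempty
  tuple.\<close>

lemma svd_index_nonempty: "svd_index \<noteq> {}"
proof
  assume empty: "svd_index = {}"
  have "\<not> 0 < s"
  proof
    assume "0 < s"
    then have "(0, 0, 0, 0) \<in> svd_index" using d_pos[of 0] by (simp add: svd_index_def)
    then show False using empty by simp
  qed
  with sum_characters[of \<one>] show False by simp
qed

lemma svd_vector_pure: "pure_tensor 3 (\<lambda>_. carrier G) (svd_vector p)"
proof -
  obtain i a b c where p: "p = (i, a, b, c)" by (cases p)
  show ?thesis
    unfolding pure_tensor_def svd_vector_def p prod.case
    by (rule exI[of _ "\<lambda>e. coeff_basis ([(i, a, b), (i, b, c), (i, c, a)] ! e)"])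
      (simp add: coeff_basis_hilbert_space)
qed

lemma svd_vector_inner:
  "tensor_inner 3 (\<lambda>_. carrier G) (svd_vector (i, a, b, c)) (tensor_prod 3 (\<lambda>_. carrier G) w)
    = hermitian_form (carrier G) (coeff_basis (i, a, b)) (w 0)
      * hermitian_form (carrier G) (coeff_basis (i, b, c)) (w 1)
      * hermitian_form (carrier G) (coeff_basis (i, c, a)) (w 2)"
  unfolding svd_vector_def using finite_carrier
  by (simp add: tensor_inner_tensor_prod prod_lessThan_3)

lemma svd_vector_norm:
  assumes "p \<in> svd_index" shows "tensor_norm 3 (\<lambda>_. carrier G) (svd_vector p) = 1"
proof -
  obtain i a b c where p: "p = (i, a, b, c)" "i < s" "a < d i" "b < d i" "c < d i"
    using assms by (auto simp: svd_index_def)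
  have "hermitian_form (carrier G) (coeff_basis q) (coeff_basis q) = 1"
    if "q \<in> {(i, a, b), (i, b, c), (i, c, a)}" for q
    using orthonormal_coeff_basis that p by (auto simp: orthonormal_def coeff_index_def)
  then show ?thesis
    unfolding tensor_norm_eq_1_iff p(1)
    by (subst (2) svd_vector_def) (simp add: svd_vector_inner)
qed

text \<open>The inner products factor into coefficients of the three factors of \<open>u\<close>,
  arranged cyclically, so \<open>cyclic_sum_le\<close> and Bessel's inequality apply. A unit pure
  tensor need not have unit factors; only the product of the squared norms \<open>N e\<close> equals
  1, and that product is all the bound involves.\<close>

lemma svd_vector_sum_le_1:
  assumes "u \<in> unit_pure_tensors 3 (\<lambda>_. carrier G)"
  shows "(\<Sum>p\<in>svd_index. cmod (tensor_inner 3 (\<lambda>_. carrier G) (svd_vector p) u)) \<le> 1"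
proof -
  obtain w where u: "u = tensor_prod 3 (\<lambda>_. carrier G) w"
    using assms by (auto simp: unit_pure_tensors_def pure_tensor_def)
  define X where "X = (\<lambda>e i a b. cmod (hermitian_form (carrier G) (coeff_basis (i, a, b)) (w e)))"
  define N where "N = (\<lambda>e. \<Sum>x\<in>carrier G. (cmod (w e x))\<^sup>2)"
  have N: "hermitian_form (carrier G) (w e) (w e) = of_real (N e)" for e
    unfolding N_def by (rule hermitian_form_self)
  have N_nonneg: "N e \<ge> 0" for e by (simp add: N_def sum_nonneg)
  have X_le: "sqrt (\<Sum>i<s. \<Sum>a<d i. \<Sum>b<d i. (X e i a b)\<^sup>2) \<le> sqrt (N e)" for e
    using bessel[OF orthonormal_coeff_basis, of "w e"]
    by (simp add: N sum_coeff_index X_def hermitian_form_commute[of _ "coeff_basis _"])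
  have "tensor_inner 3 (\<lambda>_. carrier G) u u = 1"
    using assms by (simp add: unit_pure_tensors_def tensor_norm_eq_1_iff)
  then have "(of_real (N 0 * N 1 * N 2) :: complex) = 1"
    unfolding u using finite_carrier
    by (simp add: tensor_inner_tensor_prod N prod_lessThan_3)
  then have N1: "N 0 * N 1 * N 2 = 1" unfolding of_real_eq_1_iff .
  have "(\<Sum>p\<in>svd_index. cmod (tensor_inner 3 (\<lambda>_. carrier G) (svd_vector p) u))
      = (\<Sum>i<s. \<Sum>a<d i. \<Sum>b<d i. \<Sum>c<d i. X 0 i a b * X 1 i b c * X 2 i c a)"
    unfolding sum_svd_index u svd_vector_inner X_def norm_mult ..
  also have "\<dots> \<le> sqrt (\<Sum>i<s. \<Sum>a<d i. \<Sum>b<d i. (X 0 i a b)\<^sup>2)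
      * sqrt (\<Sum>i<s. \<Sum>a<d i. \<Sum>b<d i. (X 1 i a b)\<^sup>2)
      * sqrt (\<Sum>i<s. \<Sum>a<d i. \<Sum>b<d i. (X 2 i a b)\<^sup>2)"
    by (rule cyclic_sum_le)
  also have "\<dots> \<le> sqrt (N 0) * sqrt (N 1) * sqrt (N 2)"
    using N_nonneg by (intro mult_mono X_le) (auto intro!: sum_nonneg mult_nonneg_nonneg)
  also have "\<dots> = 1" using N1 by (simp add: real_sqrt_mult[symmetric])
  finally show ?thesis .
qed

text \<open>At a fixed triple the constants combine to \<open>d i / order G\<close> and the sum over
  \<open>a\<close>, \<open>b\<close>, \<open>c\<close> is the trace of the matrix of the product of
  the three group elements, so \<open>sum_characters\<close> evaluates the whole sum as the
  indicator of product \<open>\<one>\<close>.\<close>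

lemma group_tensor_decomposition:
  "group_tensor G x = (\<Sum>p\<in>svd_index. of_real (svd_value p) * svd_vector p x)"
proof (cases "x \<in> PiE {..<3} (\<lambda>_. carrier G)")
  case True
  note x = PiE_lessThan_3[OF True]
  have "(\<Sum>p\<in>svd_index. of_real (svd_value p) * svd_vector p x)
      = (\<Sum>i<s. \<Sum>a<d i. \<Sum>b<d i. \<Sum>c<d i. of_real (d i / order G) *
          (U i (x 0) $$ (a, b) * (U i (x 1) $$ (b, c) * U i (x 2) $$ (c, a))))"
    unfolding sum_svd_index
  proof (intro sum.cong refl)
    fix i a b c assume "i \<in> {..<s}"
    then have pos: "real (order G) > 0" "real (d i) > 0" using order_pos d_pos by auto
    have scalar: "sqrt (n / k) * (sqrt (k / n) * sqrt (k / n) * sqrt (k / n)) = k / n"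
      if "n > 0" "k > 0" for n k :: real
      using that by (simp add: real_sqrt_divide)
    define \<alpha> \<beta> where "\<alpha> = complex_of_real (sqrt (order G / d i))"
      and "\<beta> = complex_of_real (sqrt (d i / order G))"
    have "\<alpha> * (\<beta> * \<beta> * \<beta>) = of_real (sqrt (order G / d i)
        * (sqrt (d i / order G) * sqrt (d i / order G) * sqrt (d i / order G)))"
      by (simp only: \<alpha>_def \<beta>_def of_real_mult)
    then have \<alpha>\<beta>: "\<alpha> * (\<beta> * \<beta> * \<beta>) = of_real (d i / order G)"
      unfolding scalar[OF pos] .
    have cb: "coeff_basis (i, k, l) y = \<beta> * U i y $$ (k, l)" if "y \<in> carrier G" for k l y
      using that by (simp add: coeff_basis_def matrix_coeff_def \<beta>_def)
    have sv: "of_real (svd_value (i, a, b, c)) = \<alpha>"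
      by (simp add: svd_value_def \<alpha>_def)
    have "of_real (svd_value (i, a, b, c)) * svd_vector (i, a, b, c) x
        = \<alpha> * (\<beta> * \<beta> * \<beta>) * (U i (x 0) $$ (a, b) * (U i (x 1) $$ (b, c) * U i (x 2) $$ (c, a)))"
      unfolding svd_vector_def prod.case tensor_prod_3 if_P[OF True] sv
      using x by (simp add: cb mult_ac)
    then show "of_real (svd_value (i, a, b, c)) * svd_vector (i, a, b, c) x
        = of_real (d i / order G) * (U i (x 0) $$ (a, b) * (U i (x 1) $$ (b, c) * U i (x 2) $$ (c, a)))"
      unfolding \<alpha>\<beta> .
  qed
  also have "\<dots> = (\<Sum>i<s. of_real (d i / order G) * (\<Sum>a<d i. U i (x 0 \<otimes> x 1 \<otimes> x 2) $$ (a, a)))"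
  proof (rule sum.cong[OF refl])
    fix i assume "i \<in> {..<s}"
    then have i: "i < s" by simp
    note c = U_carrier[OF i x(1)] U_carrier[OF i x(2)] U_carrier[OF i x(3)]
    have "U i (x 0 \<otimes> x 1 \<otimes> x 2) = U i (x 0) * (U i (x 1) * U i (x 2))"
      using x by (simp add: m_assoc representation_mult[OF U_representation[OF i]])
    then have "U i (x 0 \<otimes> x 1 \<otimes> x 2) $$ (a, a)
        = (\<Sum>b<d i. U i (x 0) $$ (a, b) * (\<Sum>c<d i. U i (x 1) $$ (b, c) * U i (x 2) $$ (c, a)))"
      if "a < d i" for a
      using c that by (simp add: scalar_prod_def atLeast0LessThan)
    then show "(\<Sum>a<d i. \<Sum>b<d i. \<Sum>c<d i. of_real (d i / order G) *
          (U i (x 0) $$ (a, b) * (U i (x 1) $$ (b, c) * U i (x 2) $$ (c, a))))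
        = of_real (d i / order G) * (\<Sum>a<d i. U i (x 0 \<otimes> x 1 \<otimes> x 2) $$ (a, a))"
      by (simp add: sum_distrib_left)
  qed
  also have "\<dots> = (if x 0 \<otimes> x 1 \<otimes> x 2 = \<one> then 1 else 0)"
    using x by (intro sum_characters) simp
  also have "\<dots> = group_tensor G x"
    unfolding group_tensor_eq[OF finite_carrier] by (simp only: True simp_thms)
  finally show ?thesis by (rule sym)
next
  case False
  then have "svd_vector p x = 0" for p
    by (cases p) (simp only: svd_vector_def prod.case tensor_prod_3 if_False)
  moreover have "group_tensor G x = 0"
    using False unfolding group_tensor_eq[OF finite_carrier] by (simp only: if_False simp_thms)
  ultimately show ?thesis by simp
qed

lemma group_tensor_diagonal_svd:
  obtains \<sigma> v where "diagonal_svd 3 (\<lambda>_. carrier G) (group_tensor G) \<sigma> v"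
    "mset \<sigma> = (\<Sum>i<s. replicate_mset (d i ^ 3) (sqrt (order G / d i)))"
proof -
  obtain ps where ps: "distinct ps" "set ps = svd_index"
    using finite_distinct_list[OF finite_svd_index] by blast
  \<comment> \<open>The negated key turns ascending sorting into the nonincreasing order that
    \<open>diagonal_svd\<close> prescribes.\<close>
  define ks where "ks = sort_key (\<lambda>p. - svd_value p) ps"
  have ks: "distinct ks" "set ks = svd_index" "sorted (map (\<lambda>p. - svd_value p) ks)"
    using ps by (simp_all add: ks_def)
  have "ks \<noteq> []" using ks(2) svd_index_nonempty by auto
  have "t_orthogonal 3 (\<lambda>_. carrier G) 2 (map svd_vector ks)"
  proof (subst t_orthogonal_2_iff)
    show "(\<forall>T\<in>set (map svd_vector ks). tensor_norm 3 (\<lambda>_. carrier G) T = 1) \<and>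
      (\<forall>u\<in>unit_pure_tensors 3 (\<lambda>_. carrier G). (\<Sum>i<length (map svd_vector ks).
        cmod (tensor_inner 3 (\<lambda>_. carrier G) (map svd_vector ks ! i) u)) \<le> 1)"
    proof (intro conjI ballI)
      fix T assume "T \<in> set (map svd_vector ks)"
      then show "tensor_norm 3 (\<lambda>_. carrier G) T = 1" using ks(2) svd_vector_norm by auto
    next
      fix u assume u: "u \<in> unit_pure_tensors 3 (\<lambda>_. carrier G)"
      then show "(\<Sum>i<length (map svd_vector ks).
          cmod (tensor_inner 3 (\<lambda>_. carrier G) (map svd_vector ks ! i) u)) \<le> 1"
        using sum_nth_distinct[OF ks(1), of "\<lambda>p. cmod (tensor_inner 3 (\<lambda>_. carrier G) (svd_vector p) u)"]
          svd_vector_sum_le_1[OF u] ks(2) by simp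
    qed
  qed (use \<open>ks \<noteq> []\<close> svd_vector_pure in auto)
  moreover have "group_tensor G = (\<lambda>x. \<Sum>i<length ks. of_real (svd_value (ks ! i)) * svd_vector (ks ! i) x)"
    using sum_nth_distinct[OF ks(1), of "\<lambda>p. of_real (svd_value p) * svd_vector p _"] ks(2)
    by (simp add: group_tensor_decomposition fun_eq_iff)
  moreover have "sorted_wrt (\<ge>) (map svd_value ks)"
    using ks(3) by (simp add: sorted_wrt_map)
  moreover have "\<forall>p\<in>set ks. svd_value p > 0"
    using ks(2) d_pos order_pos by (auto simp: svd_index_def svd_value_def)
  ultimately have "diagonal_svd 3 (\<lambda>_. carrier G) (group_tensor G) (map svd_value ks) (map svd_vector ks)"
    unfolding diagonal_svd_def using svd_vector_pure by auto
  moreover have "mset (map svd_value ks) = (\<Sum>i<s. replicate_mset (d i ^ 3) (sqrt (order G / d i)))"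
  proof -
    have "mset (map svd_value ks) = (\<Sum>p\<leftarrow>ks. {#svd_value p#})"
      by (induction ks) auto
    also have "\<dots> = (\<Sum>p\<in>svd_index. {#svd_value p#})"
      by (simp only: ks(2)[symmetric] sum.distinct_set_conv_list[OF ks(1)])
    also have "\<dots> = (\<Sum>i<s. \<Sum>p\<in>{..<d i} \<times> {..<d i} \<times> {..<d i}. {#sqrt (order G / d i)#})"
      unfolding svd_index_def svd_value_def by (subst sum.Sigma) (auto intro!: sum.cong)
    also have "\<dots> = (\<Sum>i<s. replicate_mset (d i ^ 3) (sqrt (order G / d i)))"
      by (simp add: sum_singleton_mset_const card_cartesian_product power3_eq_cube mult.assoc)
    finally show ?thesis .
  qed
  ultimately show thesis by (rule that)
qed

end

theorem theorem1p11:
  fixes G :: "('a, 'b) monoid_scheme"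
    and n s :: nat
    and d :: "nat \<Rightarrow> nat"
    and \<rho> :: "nat \<Rightarrow> 'a \<Rightarrow> complex mat"
  assumes "group G"
    and "finite (carrier G)"
    and "order G = n"
    and "irreducible_reps_system G s d \<rho>"
  shows "(\<exists>\<sigma> v. diagonal_svd 3 (\<lambda>_. carrier G) (group_tensor G) \<sigma> v) \<and>
    (\<forall>\<sigma> v. diagonal_svd 3 (\<lambda>_. carrier G) (group_tensor G) \<sigma> v \<longrightarrow>
      mset \<sigma> = (\<Sum>i<s. replicate_mset (d i ^ 3) (sqrt (real n / real (d i)))))"
proof -
  interpret finite_group G
    using assms(1,2) by (simp add: finite_group_def finite_group_axioms_def)
  obtain U where "irreducible_reps_system G s d U" "\<And>i. i < s \<Longrightarrow> unitary_rep G (d i) (U i)"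
    by (rule unitary_irreducible_reps_system[OF assms(4)]) (rule that)
  then interpret unitary_irreps G s d U by unfold_locales
  obtain \<sigma> v where "diagonal_svd 3 (\<lambda>_. carrier G) (group_tensor G) \<sigma> v"
    "mset \<sigma> = (\<Sum>i<s. replicate_mset (d i ^ 3) (sqrt (n / d i)))"
    using group_tensor_diagonal_svd unfolding assms(3) .
  \<comment> \<open>A single decomposition with the stated multiset settles both claims, since any
    other decomposition has the same multiset of singular values.\<close>
  then show ?thesis using diagonal_svd_unique by metis
qed

end
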